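(* Let $g:[0,\infty)\to(0,\infty)$ be an $\mathrm{RV}_{-1}$-function with $\int_0^\infty g(t)\,dt=\infty$ and $t^{-1}=O(g(t))$ as $t\to\infty$. Let $g_1:[0,\infty)\to(0,\infty)$ be a continuous $\mathrm{RV}_{-1}$-function of the form $g_1(t)=g(t)(1+\varepsilon(t))$, $t\ge0$, where $\varepsilon:[0,\infty)\to(0,\infty)$ is a continuous decreasing function with $\lim_{t\to\infty}\varepsilon(t)=0$ (so that $\mathcal L_{g_1}=\mathcal L_g$). The following hold. (1) If $\int_0^t\varepsilon(s)g(s)\,ds=O(tg(t))$ as $t\to\infty$, then for traces $\varphi$ on $\mathcal L_g$ the normalization conditions $\varphi(T_g)=1$ and $\varphi(T_{g_1})=1$ are equivalent, and so $\mathcal M_h^{g_1}(\mathcal L_g)=\mathcal M_h^g(\mathcal L_g)$. (2) If $tg(t)=o\bigl(\int_0^t\varepsilon(s)g(s)\,ds\bigr)$ as $t\to\infty$, then $T_{g_1}$ is not $g$-hypermeasurable and $T_g$ is not $g_1$-hypermeasurable, and so $\mathcal M_h^{g_1}(\mathcal L_g)\ne\mathcal M_h^g(\mathcal L_g)$.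
   Context: $\mathcal H$ is a separable (infinite-dimensional) Hilbert space, and $\mu_0(T)\ge\mu_1(T)\ge\cdots$ are the singular values of a compact operator $T$ on $\mathcal H$. A continuous function $g:[0,\infty)\to(0,\infty)$ is $\mathrm{RV}_{-1}$ if it is ultimately monotonic and $\lim_{t\to\infty}g(\lambda t)/g(t)=\lambda^{-1}$ for all $\lambda>0$. The weak Lorentz ideal is $\mathcal L_g=\{T \text{ compact}:\mu_j(T)=O(g(j))\}$. A trace on $\mathcal L_g$ is a linear functional on $\mathcal L_g$ (no continuity or positivity required) vanishing on all commutators $[A,T]$ with $A$ bounded and $T\in\mathcal L_g$. $T_g$ is any operator with $T_g\xi_j=g(j)\xi_j$, $j\ge0$, for some orthonormal basis $(\xi_j)_{j\ge0}$ of $\mathcal H$, and $T_{g_1}$ is defined likewise from $g_1$. A trace is $g$-normalized if $\varphi(T_g)=1$. $T\in\mathcal L_g$ is $g$-hypermeasurable if all $g$-normalized traces take the same value on $T$; $\mathcal M_h^g(\mathcal L_g)$ is the space of $g$-hypermeasurable operators. The same definitions apply with $g_1$ in place of $g$. *)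

theory Defs
  imports "HOL-Analysis.Analysis" "HOL-Library.Landau_Symbols"
begin

text \<open>
  Complex Hilbert spaces.  The underlying real Hilbert space structure (and with it norm, metric and
  topology) is that of the library; its inner product is the real part of the complex one, so that
  \<open>norm x = sqrt (Re (cinner x x))\<close> by \<open>norm_eq_sqrt_inner\<close>.
\<close>

class complex_hilbert = real_inner + complete_space +
  fixes scaleC :: "complex \<Rightarrow> 'a \<Rightarrow> 'a"  (infixr \<open>*\<^sub>C\<close> 75)
    and cinner :: "'a \<Rightarrow> 'a \<Rightarrow> complex"
  assumes scaleC_add_right: "c *\<^sub>C (x + y) = c *\<^sub>C x + c *\<^sub>C y"
    and scaleC_add_left: "(c + d) *\<^sub>C x = c *\<^sub>C x + d *\<^sub>C x"
    and scaleC_scaleC: "c *\<^sub>C (d *\<^sub>C x) = (c * d) *\<^sub>C x"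
    and scaleC_of_real: "complex_of_real r *\<^sub>C x = r *\<^sub>R x"
    and cinner_commute: "cinner x y = cnj (cinner y x)"
    and cinner_add_left: "cinner (x + y) z = cinner x z + cinner y z"
    and cinner_scaleC_left: "cinner (c *\<^sub>C x) y = c * cinner x y"
    and inner_eq_Re_cinner: "inner x y = Re (cinner x y)"

global_interpretation complex_vector: vector_space "scaleC :: complex \<Rightarrow> 'a \<Rightarrow> 'a::complex_hilbert"
  defines cspan = complex_vector.span
    and cdim = complex_vector.dim
proof unfold_locales
  show "1 *\<^sub>C x = x" for x :: 'a
    using scaleC_of_real[of 1 x] by simp
qed (simp_all add: scaleC_add_right scaleC_add_left scaleC_scaleC)

definition orthonormal_basis :: "(nat \<Rightarrow> 'a::complex_hilbert) \<Rightarrow> bool" where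
  "orthonormal_basis \<xi> \<longleftrightarrow>
     (\<forall>i j. cinner (\<xi> i) (\<xi> j) = (if i = j then 1 else 0)) \<and>
     closure (cspan (range \<xi>)) = UNIV"

definition bounded_clinear :: "('a::complex_hilbert \<Rightarrow> 'a) \<Rightarrow> bool" where
  "bounded_clinear T \<longleftrightarrow> bounded_linear T \<and> (\<forall>c x. T (c *\<^sub>C x) = c *\<^sub>C T x)"

definition compact_operator :: "('a::complex_hilbert \<Rightarrow> 'a) \<Rightarrow> bool" where
  "compact_operator T \<longleftrightarrow> bounded_clinear T \<and> compact (closure (T ` cball 0 1))"

definition cadjoint :: "('a::complex_hilbert \<Rightarrow> 'a) \<Rightarrow> 'a \<Rightarrow> 'a" where
  "cadjoint T = (THE S. \<forall>x y. cinner (T x) y = cinner x (S y))"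

definition positive_operator :: "('a::complex_hilbert \<Rightarrow> 'a) \<Rightarrow> bool" where
  "positive_operator P \<longleftrightarrow> bounded_clinear P \<and> (\<forall>x. cinner (P x) x \<in> \<real>\<^sub>\<ge>\<^sub>0)"

definition abs_operator :: "('a::complex_hilbert \<Rightarrow> 'a) \<Rightarrow> 'a \<Rightarrow> 'a" where
  "abs_operator T = (THE P. positive_operator P \<and> P \<circ> P = cadjoint T \<circ> T)"

text \<open>
  \<open>singular_value T j\<close> is the \<open>(j+1)\<close>-th eigenvalue of \<open>|T|\<close>, the eigenvalues being arranged in
  nonincreasing order and counted with multiplicity.  For compact \<open>T\<close> the eigenspaces at \<open>s > 0\<close>
  are finite-dimensional and the conditions below determine the sequence; if \<open>T\<close> has finite rank,
  it is eventually \<open>0\<close>.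
\<close>

definition singular_value :: "('a::complex_hilbert \<Rightarrow> 'a) \<Rightarrow> nat \<Rightarrow> real" where
  "singular_value T = (THE \<mu>. decseq \<mu> \<and> \<mu> \<longlonglongrightarrow> 0 \<and>
     (\<forall>s>0. card {j. \<mu> j = s} = cdim {x. abs_operator T x = s *\<^sub>R x}))"

text \<open>Functions on \<open>[0,\<infinity>)\<close> are functions on the reals of which only the values on \<open>{0..}\<close> matter.\<close>

definition RV_minus_one :: "(real \<Rightarrow> real) \<Rightarrow> bool" where
  "RV_minus_one g \<longleftrightarrow>
     continuous_on {0..} g \<and> (\<forall>t\<ge>0. g t > 0) \<and>
     (\<exists>a\<ge>0. mono_on {a..} g \<or> antimono_on {a..} g) \<and>
     (\<forall>c>0. ((\<lambda>t. g (c * t) / g t) \<longlongrightarrow> inverse c) at_top)"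

definition weak_lorentz :: "(real \<Rightarrow> real) \<Rightarrow> ('a::complex_hilbert \<Rightarrow> 'a) set" where
  "weak_lorentz g =
     {T. compact_operator T \<and> (\<lambda>j. singular_value T j) \<in> O(\<lambda>j. g (real j))}"

definition model_operator :: "(real \<Rightarrow> real) \<Rightarrow> ('a::complex_hilbert \<Rightarrow> 'a) \<Rightarrow> bool" where
  "model_operator g T \<longleftrightarrow> bounded_clinear T \<and>
     (\<exists>\<xi>. orthonormal_basis \<xi> \<and> (\<forall>j. T (\<xi> j) = g (real j) *\<^sub>R \<xi> j))"

text \<open>Traces are total functions of which only the values on the ideal \<open>I\<close> matter.\<close>

definition trace_on ::
    "('a::complex_hilbert \<Rightarrow> 'a) set \<Rightarrow> (('a \<Rightarrow> 'a) \<Rightarrow> complex) \<Rightarrow> bool" where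
  "trace_on I \<phi> \<longleftrightarrow>
     (\<forall>S\<in>I. \<forall>T\<in>I. \<phi> (\<lambda>x. S x + T x) = \<phi> S + \<phi> T) \<and>
     (\<forall>c. \<forall>T\<in>I. \<phi> (\<lambda>x. c *\<^sub>C T x) = c * \<phi> T) \<and>
     (\<forall>A. \<forall>T\<in>I. bounded_clinear A \<longrightarrow> \<phi> (\<lambda>x. A (T x) - T (A x)) = 0)"

text \<open>
  The space \<open>M\<^sub>h\<^sup>g(I)\<close>, where \<open>N\<close> is the operator \<open>T\<^sub>g\<close> (for some choice of orthonormal
  basis) used for the normalization.
\<close>

definition hypermeasurable ::
    "('a::complex_hilbert \<Rightarrow> 'a) set \<Rightarrow> ('a \<Rightarrow> 'a) \<Rightarrow> ('a \<Rightarrow> 'a) set" where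
  "hypermeasurable I N =
     {T \<in> I. \<forall>\<phi> \<psi>. trace_on I \<phi> \<and> \<phi> N = 1 \<and> trace_on I \<psi> \<and> \<psi> N = 1 \<longrightarrow> \<phi> T = \<psi> T}"

end

theory Submission
  imports Defs "HOL-Library.Function_Algebras"
begin

text \<open>
  Write \<open>Com\<close> for the linear span of the commutators \<open>[A, T]\<close> with \<open>A\<close> bounded and \<open>T\<close> in
  the ideal.  Traces are the linear functionals that vanish on \<open>Com\<close>, so every assertion about
  normalized traces is an assertion about membership in \<open>Com\<close>.  Operators that are diagonal with
  the same entries in two orthonormal bases differ by a commutator; up to this, \<open>T\<^bsub>g1\<^esub>\<close> is
  \<open>T\<^sub>g + D\<close> with \<open>D\<close> diagonal in the basis of \<open>T\<^sub>g\<close> with entries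
  \<open>a\<^sub>j = \<epsilon>(j) g(j)\<close>.  A diagonal operator of the ideal with decreasing entries lies in
  \<open>Com\<close> precisely when the arithmetic means of its entries are \<open>O(g(n))\<close>, and each implication
  gives one of the two assertions.

  If the means of \<open>a\<close> are \<open>O(g(n))\<close>, arrange the natural numbers as a binary tree and solve
  \<open>a\<^sub>j = b\<^sub>j - b\<^bsub>parent j\<^esub> / 2\<close>.  The solution \<open>b\<close> is bounded by a multiple of the means
  of \<open>a\<close>, hence gives an operator of the ideal; and placing each \<open>b\<^sub>p\<close> at both children of \<open>p\<close>
  doubles every trace, since it produces two copies of the operator with entries \<open>b\<close>.  So
  traces vanish on \<open>D\<close> (\<open>trace_vanishes_if_means_dominated\<close>), and the first assertion follows.

  Conversely, let \<open>X\<close> be a finite sum of commutators \<open>[A, T]\<close> in the ideal.  For each \<open>n\<close>, every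
  \<open>T\<close> is a sum of an operator of rank at most \<open>n\<close> and one of norm \<open>O(g(n))\<close>.  Compress to a
  subspace of dimension \<open>O(n)\<close> that contains \<open>\<xi>\<^sub>0, \<dots>, \<xi>\<^bsub>n-1\<^esub>\<close> and carries all the
  finite-rank parts: these contribute trace \<open>0\<close>, and the rest contributes \<open>O(n g(n))\<close>.  If \<open>X\<close>
  is diagonal with entries \<open>x\<^sub>j = O(g(j))\<close>, this gives
  \<open>x\<^sub>0 + \<dots> + x\<^bsub>n-1\<^esub> = O(n g(n))\<close> (\<open>small_compressions_diagonal\<close>).  In the second
  assertion the partial sums of \<open>a\<close> dominate \<open>n g(n)\<close> and are in turn negligible against those of
  \<open>g\<close>, since \<open>\<epsilon>\<close> tends to \<open>0\<close> and the latter diverge; so no combination of \<open>T\<^sub>g\<close> and \<open>D\<close>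
  other than \<open>0\<close> lies in \<open>Com\<close>, and linear algebra provides traces with arbitrary values on
  \<open>T\<^sub>g\<close> and \<open>T\<^bsub>g1\<^esub>\<close>.

  Both arguments speak of approximation by operators of finite rank, whereas the ideal is
  defined by the eigenvalues of \<open>|T|\<close>.  The bridge (\<open>weak_lorentz_iff_approximable\<close>) is the
  singular value decomposition of compact operators, obtained by maximizing \<open>\<parallel>T x\<parallel>\<close>
  successively on orthogonal complements.
\<close>

section \<open>Geometry of complex Hilbert spaces\<close>

instance complex_hilbert \<subseteq> banach
  by standard

lemma cinner_add_right: "cinner x (y + z) = cinner x y + cinner x z"
  for x y z :: "'a::complex_hilbert"
  by (metis cinner_add_left cinner_commute complex_cnj_add)

lemma cinner_scaleC_right: "cinner x (c *\<^sub>C y) = cnj c * cinner x y"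
  for x y :: "'a::complex_hilbert"
  by (metis cinner_commute cinner_scaleC_left complex_cnj_mult)

lemma cinner_self: "cinner x x = of_real ((norm x)\<^sup>2)" for x :: "'a::complex_hilbert"
proof -
  have "Im (cinner x x) = 0"
    using cinner_commute[of x x] by (simp add: complex_eq_iff)
  then show ?thesis
    by (simp add: complex_eq_iff power2_norm_eq_inner inner_eq_Re_cinner)
qed

lemma norm_scaleC: "norm (c *\<^sub>C x) = cmod c * norm x" for x :: "'a::complex_hilbert"
proof -
  have "complex_of_real ((norm (c *\<^sub>C x))\<^sup>2) = c * cnj c * of_real ((norm x)\<^sup>2)"
    by (simp only: cinner_self[symmetric] cinner_scaleC_left cinner_scaleC_right) (simp add: mult_ac)
  also have "\<dots> = of_real ((cmod c * norm x)\<^sup>2)"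
    by (simp add: complex_norm_square[symmetric] power_mult_distrib)
  finally have "(norm (c *\<^sub>C x))\<^sup>2 = (cmod c * norm x)\<^sup>2"
    using of_real_eq_iff by blast
  then show ?thesis by (simp add: power2_eq_iff_nonneg)
qed

lemma norm_cinner_le: "cmod (cinner x y) \<le> norm x * norm y" for x y :: "'a::complex_hilbert"
proof (cases "cinner x y = 0")
  case False
  (* Rotating x makes the inner product real, which reduces the claim to the real inner product. *)
  define c where "c = cnj (cinner x y) / of_real (cmod (cinner x y))"
  have c: "cmod c = 1" "c * cinner x y = of_real (cmod (cinner x y))"
    using False complex_norm_square[of "cinner x y"]
    by (simp_all add: c_def norm_divide field_simps power2_eq_square)
  have "cmod (cinner x y) = inner (c *\<^sub>C x) y"
    by (simp add: inner_eq_Re_cinner cinner_scaleC_left c)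
  also have "\<dots> \<le> norm (c *\<^sub>C x) * norm y"
    by (rule norm_cauchy_schwarz)
  finally show ?thesis by (simp add: norm_scaleC c)
qed simp

interpretation cinner: bounded_bilinear "cinner :: 'a::complex_hilbert \<Rightarrow> 'a \<Rightarrow> complex"
proof
  fix x y z :: 'a and r :: real
  show "cinner (r *\<^sub>R x) y = r *\<^sub>R cinner x y" "cinner x (r *\<^sub>R y) = r *\<^sub>R cinner x y"
    by (simp_all add: scaleC_of_real[symmetric] cinner_scaleC_left cinner_scaleC_right
        scaleR_conv_of_real)
  show "\<exists>K. \<forall>x y::'a. cmod (cinner x y) \<le> norm x * norm y * K"
    by (rule exI[of _ 1]) (simp add: norm_cinner_le)
qed (simp_all add: cinner_add_left cinner_add_right)

interpretation scaleC: bounded_bilinear "scaleC :: complex \<Rightarrow> 'a::complex_hilbert \<Rightarrow> 'a"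
proof
  fix c :: complex and x :: 'a and r :: real
  show "(r *\<^sub>R c) *\<^sub>C x = r *\<^sub>R c *\<^sub>C x" "c *\<^sub>C r *\<^sub>R x = r *\<^sub>R c *\<^sub>C x"
    by (simp_all add: scaleC_of_real[symmetric] scaleC_scaleC scaleR_conv_of_real mult.commute)
  show "\<exists>K. \<forall>(a::complex) b::'a. norm (a *\<^sub>C b) \<le> norm a * norm b * K"
    by (rule exI[of _ 1]) (simp add: norm_scaleC)
qed (simp_all add: scaleC_add_left scaleC_add_right)

declare cinner.zero_left [simp] cinner.zero_right [simp] scaleC.zero_left [simp] scaleC.zero_right [simp]

lemmas scaleC_one [simp] = complex_vector.scale_one
lemmas cinner_simps = cinner_add_left cinner_add_right cinner_scaleC_left cinner_scaleC_right
  cinner.diff_left cinner.diff_right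

lemma cinner_eq_0_sym: "cinner x y = 0 \<Longrightarrow> cinner y x = 0" for x y :: "'a::complex_hilbert"
  by (metis cinner_commute complex_cnj_zero)

lemma cinner_self_eq_0 [simp]: "cinner x x = 0 \<longleftrightarrow> x = 0" for x :: "'a::complex_hilbert"
  by (simp add: cinner_self)

lemma cinner_ext:
  fixes y z :: "'a::complex_hilbert"
  assumes "\<And>x. cinner x y = cinner x z"
  shows "y = z"
proof -
  have "cinner (y - z) (y - z) = 0"
    using assms[of "y - z"] by (simp add: cinner.diff_right)
  then show ?thesis by simp
qed

lemma norm_add_squared_orthogonal:
  fixes x y :: "'a::complex_hilbert"
  assumes "cinner x y = 0"
  shows "(norm (x + y))\<^sup>2 = (norm x)\<^sup>2 + (norm y)\<^sup>2"
  using assms cinner_eq_0_sym[OF assms]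
  by (simp add: power2_norm_eq_inner inner_eq_Re_cinner cinner_simps)

lemma norm_sum_squared_orthogonal:
  fixes f :: "'i \<Rightarrow> 'a::complex_hilbert"
  assumes "finite I" "\<And>i j. i \<in> I \<Longrightarrow> j \<in> I \<Longrightarrow> i \<noteq> j \<Longrightarrow> cinner (f i) (f j) = 0"
  shows "(norm (\<Sum>i\<in>I. f i))\<^sup>2 = (\<Sum>i\<in>I. (norm (f i))\<^sup>2)"
  using assms
proof (induction I)
  case (insert i I)
  have "cinner (f i) (\<Sum>i\<in>I. f i) = 0"
    unfolding cinner.sum_right using insert by (intro sum.neutral) (metis insertCI)
  then show ?case
    using insert by (simp add: norm_add_squared_orthogonal)
qed simp


section \<open>Bounded complex-linear operators\<close>

lemma bounded_clinearI:
  fixes T :: "'a::complex_hilbert \<Rightarrow> 'a"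
  assumes "\<And>x y. T (x + y) = T x + T y" "\<And>c x. T (c *\<^sub>C x) = c *\<^sub>C T x"
    and "\<And>x. norm (T x) \<le> K * norm x"
  shows "bounded_clinear T"
proof -
  have "bounded_linear T"
    by (rule bounded_linear_intro[of _ K])
      (use assms in \<open>simp_all add: scaleC_of_real[symmetric] mult.commute\<close>)
  then show ?thesis using assms(2) by (simp add: bounded_clinear_def)
qed

lemma bounded_clinear_bounded_linear: "bounded_clinear T \<Longrightarrow> bounded_linear T"
  by (simp add: bounded_clinear_def)

lemma bounded_clinear_scaleC: "bounded_clinear T \<Longrightarrow> T (c *\<^sub>C x) = c *\<^sub>C T x"
  by (simp add: bounded_clinear_def)

lemmas bounded_clinear_add = linear_simps(1)[OF bounded_clinear_bounded_linear]
lemmas bounded_clinear_diff = linear_simps(2)[OF bounded_clinear_bounded_linear]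
lemmas bounded_clinear_zero = linear_simps(3)[OF bounded_clinear_bounded_linear]
lemmas bounded_clinear_sum = linear_sum[OF bounded_linear.linear[OF bounded_clinear_bounded_linear]]

lemma bounded_clinear_bound:
  assumes "bounded_clinear T"
  obtains K where "K > 0" "\<And>x. norm (T x) \<le> K * norm x"
  using bounded_linear.pos_bounded[OF bounded_clinear_bounded_linear[OF assms]]
  by (auto simp: mult.commute)

lemma bounded_clinear_tendsto:
  assumes "bounded_clinear T" "(f \<longlongrightarrow> l) F"
  shows "((\<lambda>x. T (f x)) \<longlongrightarrow> T l) F"
  using bounded_linear.tendsto[OF bounded_clinear_bounded_linear] assms by blast

lemma bounded_clinear_add_fun:
  "bounded_clinear S \<Longrightarrow> bounded_clinear T \<Longrightarrow> bounded_clinear (\<lambda>x. S x + T x)"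
  by (simp add: bounded_clinear_def bounded_linear_add scaleC_add_right)

lemma bounded_clinear_eq_on_dense:
  assumes "bounded_clinear S" "bounded_clinear T" "closure (cspan X) = UNIV"
    and "\<And>x. x \<in> X \<Longrightarrow> S x = T x"
  shows "S = T"
proof
  fix x
  have span: "S y = T y" if "y \<in> cspan X" for y
    using that
  proof (induction rule: complex_vector.span_induct_alt)
    case base
    then show ?case
      using bounded_clinear_zero[OF assms(1)] bounded_clinear_zero[OF assms(2)] by simp
  next
    case (step c x y)
    then show ?case
      using assms by (simp add: bounded_clinear_add bounded_clinear_scaleC)
  qed
  obtain y where y: "\<And>n. y n \<in> cspan X" "y \<longlonglongrightarrow> x"
    using assms(3) closure_sequential[of x "cspan X"] by auto
  have "(\<lambda>n. S (y n)) \<longlonglongrightarrow> S x" "(\<lambda>n. T (y n)) \<longlonglongrightarrow> T x"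
    using assms(1,2) y(2) by (auto intro: bounded_clinear_tendsto)
  then show "S x = T x"
    using span[OF y(1)] LIMSEQ_unique by simp
qed


section \<open>Orthonormal families\<close>

definition orthonormal_seq :: "(nat \<Rightarrow> 'a::complex_hilbert) \<Rightarrow> bool" where
  "orthonormal_seq e \<longleftrightarrow> (\<forall>i j. cinner (e i) (e j) = (if i = j then 1 else 0))"

definition orthonormal_set :: "'a::complex_hilbert set \<Rightarrow> bool" where
  "orthonormal_set B \<longleftrightarrow> (\<forall>x\<in>B. \<forall>y\<in>B. cinner x y = (if x = y then 1 else 0))"

lemma orthonormal_seqD: "orthonormal_seq e \<Longrightarrow> cinner (e i) (e j) = (if i = j then 1 else 0)"
  by (simp add: orthonormal_seq_def)

lemma orthonormal_setD:
  "orthonormal_set B \<Longrightarrow> x \<in> B \<Longrightarrow> y \<in> B \<Longrightarrow> cinner x y = (if x = y then 1 else 0)"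
  by (simp add: orthonormal_set_def)

lemma orthonormal_basis_seq: "orthonormal_basis \<xi> \<Longrightarrow> orthonormal_seq \<xi>"
  by (simp add: orthonormal_basis_def orthonormal_seq_def)

lemma orthonormal_seq_norm: "orthonormal_seq e \<Longrightarrow> norm (e i) = 1"
  using cinner_self[of "e i"]
  by (metis norm_ge_zero norm_one of_real_1 of_real_eq_iff one_power2 orthonormal_seq_def
      power2_eq_iff_nonneg zero_le_one)

lemma orthonormal_set_norm: "orthonormal_set B \<Longrightarrow> b \<in> B \<Longrightarrow> norm b = 1"
  using cinner_self[of b]
  by (metis norm_ge_zero of_real_1 of_real_eq_iff one_power2 orthonormal_set_def
      power2_eq_iff_nonneg zero_le_one)

lemma orthonormal_seq_inj: "orthonormal_seq e \<Longrightarrow> inj e"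
  by (metis injI one_neq_zero orthonormal_seq_def)

lemma orthonormal_seq_image: "orthonormal_seq e \<Longrightarrow> orthonormal_set (e ` I)"
  by (auto simp: orthonormal_seq_def orthonormal_set_def) (metis one_neq_zero)

lemma orthonormal_seq_comp: "orthonormal_seq e \<Longrightarrow> inj h \<Longrightarrow> orthonormal_seq (\<lambda>j. e (h j))"
  by (simp add: orthonormal_seq_def inj_eq)

lemma sum_orthonormal_set:
  assumes "orthonormal_set B" "finite B" "b \<in> B"
  shows "(\<Sum>x\<in>B. c x * cinner x b) = c b" "(\<Sum>x\<in>B. cinner b x *\<^sub>C f x) = f b"
proof -
  have "(\<Sum>x\<in>B. c x * cinner x b) = (\<Sum>x\<in>B. if x = b then c b else 0)"
    using assms by (intro sum.cong) (auto simp: orthonormal_set_def)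
  then show "(\<Sum>x\<in>B. c x * cinner x b) = c b" using assms by simp
  have "(\<Sum>x\<in>B. cinner b x *\<^sub>C f x) = (\<Sum>x\<in>B. if x = b then f b else 0)"
    using assms by (intro sum.cong) (auto simp: orthonormal_set_def)
  then show "(\<Sum>x\<in>B. cinner b x *\<^sub>C f x) = f b" using assms by simp
qed

lemma norm_orthonormal_sum_squared:
  assumes "orthonormal_seq f" "finite I"
  shows "(norm (\<Sum>j\<in>I. c j *\<^sub>C f j))\<^sup>2 = (\<Sum>j\<in>I. (cmod (c j))\<^sup>2)"
proof -
  have "(norm (\<Sum>j\<in>I. c j *\<^sub>C f j))\<^sup>2 = (\<Sum>j\<in>I. (norm (c j *\<^sub>C f j))\<^sup>2)"
    using assms by (intro norm_sum_squared_orthogonal) (simp_all add: cinner_simps orthonormal_seq_def)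
  then show ?thesis by (simp add: norm_scaleC orthonormal_seq_norm[OF assms(1)])
qed

lemma projection_remainder:
  fixes x :: "'a::complex_hilbert"
  assumes "orthonormal_seq e" "finite I"
  defines "p \<equiv> \<Sum>j\<in>I. cinner x (e j) *\<^sub>C e j"
  shows "i \<in> I \<Longrightarrow> cinner (x - p) (e i) = 0"
    and "(norm x)\<^sup>2 = (norm p)\<^sup>2 + (norm (x - p))\<^sup>2"
proof -
  show orth: "cinner (x - p) (e i) = 0" if "i \<in> I" for i
  proof -
    have "cinner p (e i) = (\<Sum>j\<in>I. if j = i then cinner x (e i) else 0)"
      unfolding p_def cinner.sum_left
      by (intro sum.cong) (auto simp: cinner_simps orthonormal_seqD[OF assms(1)])
    then show ?thesis using that assms by (simp add: cinner_simps)
  qed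
  have "cinner (x - p) p = (\<Sum>j\<in>I. cnj (cinner x (e j)) * cinner (x - p) (e j))"
    using cinner.sum_right[of "x - p" "\<lambda>j. cinner x (e j) *\<^sub>C e j" I]
    by (simp add: p_def cinner_scaleC_right)
  also have "\<dots> = 0" using orth by simp
  finally have "cinner p (x - p) = 0" by (rule cinner_eq_0_sym)
  then show "(norm x)\<^sup>2 = (norm p)\<^sup>2 + (norm (x - p))\<^sup>2"
    using norm_add_squared_orthogonal[of p "x - p"] by simp
qed

lemma norm_projection_remainder_le:
  assumes "orthonormal_seq e" "finite I"
  shows "norm (x - (\<Sum>j\<in>I. cinner x (e j) *\<^sub>C e j)) \<le> norm x"
  by (rule power2_le_imp_le) (use projection_remainder(2)[OF assms, of x] in auto)

lemma bessel:
  assumes "orthonormal_seq e" "finite I"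
  shows "(\<Sum>j\<in>I. (cmod (cinner x (e j)))\<^sup>2) \<le> (norm x)\<^sup>2"
  using projection_remainder(2)[OF assms, of x] norm_orthonormal_sum_squared[OF assms] by simp

lemma bessel_summable:
  assumes "orthonormal_seq e"
  shows "summable (\<lambda>j. (cmod (cinner x (e j)))\<^sup>2)"
  by (rule summableI_nonneg_bounded[of _ "(norm x)\<^sup>2"]) (simp_all add: bessel[OF assms])

lemma orthonormal_series_summable:
  assumes "orthonormal_seq f" "summable (\<lambda>j. (cmod (c j))\<^sup>2)"
  shows "summable (\<lambda>j. c j *\<^sub>C f j)"
  unfolding summable_Cauchy
proof (intro allI impI)
  fix r :: real assume "r > 0"
  then obtain N where N: "\<And>m n. m \<ge> N \<Longrightarrow> norm (\<Sum>j=m..<n. (cmod (c j))\<^sup>2) < r\<^sup>2"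
    using assms(2) unfolding summable_Cauchy by (metis zero_less_power)
  have "norm (\<Sum>j=m..<n. c j *\<^sub>C f j) < r" if "m \<ge> N" for m n
  proof (rule power2_less_imp_less)
    show "(norm (\<Sum>j=m..<n. c j *\<^sub>C f j))\<^sup>2 < r\<^sup>2"
      using N[OF that, of n] by (simp add: norm_orthonormal_sum_squared[OF assms(1)] sum_nonneg)
  qed (use \<open>r > 0\<close> in simp)
  then show "\<exists>N. \<forall>m\<ge>N. \<forall>n. norm (\<Sum>j=m..<n. c j *\<^sub>C f j) < r" by blast
qed

text \<open>
  The finite-dimensional Gram--Schmidt process, with the dimension count that makes traces of
  compressions comparable: enlarging the span by finitely many vectors costs at most as many new
  basis vectors.
\<close>

lemma gram_schmidt_extend:
  assumes "finite F" "finite B" "orthonormal_set B"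
  shows "\<exists>B'. B \<subseteq> B' \<and> finite B' \<and> orthonormal_set B' \<and> F \<subseteq> cspan B' \<and> card B' \<le> card B + card F"
  using assms(1)
proof (induction F)
  case empty
  then show ?case using assms(2,3) by auto
next
  case (insert x F)
  then obtain B' where B': "B \<subseteq> B'" "finite B'" "orthonormal_set B'" "F \<subseteq> cspan B'"
    "card B' \<le> card B + card F" by blast
  define p where "p = (\<Sum>b\<in>B'. cinner x b *\<^sub>C b)"
  have p: "p \<in> cspan B'"
    unfolding p_def
    by (intro complex_vector.span_sum complex_vector.span_scale complex_vector.span_base)
  show ?case
  proof (cases "x = p")
    case True
    then show ?thesis using B' p insert.hyps by (intro exI[of _ B']) auto
  next
    case False
    define v where "v = complex_of_real (inverse (norm (x - p))) *\<^sub>C (x - p)"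
    have orth: "cinner (x - p) b = 0" if "b \<in> B'" for b
      using that B' by (simp add: p_def cinner_simps cinner.sum_left sum_orthonormal_set)
    have vb: "cinner v b = 0" "cinner b v = 0" if "b \<in> B'" for b
      using orth[OF that] cinner_eq_0_sym[OF orth[OF that]] by (simp_all add: v_def cinner_simps)
    have "norm v = 1" using False by (simp add: v_def norm_scaleC norm_inverse)
    then have vv: "cinner v v = 1" by (simp add: cinner_self)
    then have "v \<notin> B'" using vb[of v] by auto
    have "orthonormal_set (insert v B')"
      unfolding orthonormal_set_def
      using vv vb B'(3) \<open>v \<notin> B'\<close> by (auto simp: orthonormal_set_def)
    moreover have "x \<in> cspan (insert v B')"
    proof -
      have "x = p + complex_of_real (norm (x - p)) *\<^sub>C v"
        using False by (simp add: v_def scaleC_scaleC flip: of_real_mult)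
      then show ?thesis
        using complex_vector.span_mono[of B' "insert v B'"] p
          complex_vector.span_add[of p "insert v B'" "complex_of_real (norm (x - p)) *\<^sub>C v"]
          complex_vector.span_scale[OF complex_vector.span_base[of v "insert v B'"]]
        by (metis insertI1 subsetD subset_insertI)
    qed
    moreover have "F \<subseteq> cspan (insert v B')"
      using B'(4) complex_vector.span_mono[of B' "insert v B'"] by blast
    ultimately show ?thesis
      using B' insert.hyps \<open>v \<notin> B'\<close> by (intro exI[of _ "insert v B'"]) auto
  qed
qed

lemma parseval_in_span:
  assumes "finite B" "orthonormal_set B" "u \<in> cspan B"
  shows "(\<Sum>b\<in>B. cinner u b *\<^sub>C b) = u"
  using assms(3)
proof (induction rule: complex_vector.span_induct_alt)
  case (step c x y)
  have "(\<Sum>b\<in>B. cinner x b *\<^sub>C b) = x"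
    using step(1) assms by (simp add: sum_orthonormal_set)
  moreover have "(\<Sum>b\<in>B. (c * cinner x b) *\<^sub>C b) = c *\<^sub>C (\<Sum>b\<in>B. cinner x b *\<^sub>C b)"
    by (simp add: scaleC_scaleC scaleC.sum_right)
  ultimately show ?case
    using step(2) by (simp add: cinner_simps scaleC_add_left sum.distrib)
qed simp

lemma parseval_finite:
  assumes "finite B" "orthonormal_set B" "u \<in> cspan B \<or> v \<in> cspan B"
  shows "(\<Sum>b\<in>B. cinner u b * cinner b v) = cinner u v"
proof -
  have *: "(\<Sum>b\<in>B. cinner u b * cinner b v) = cinner u v" if "u \<in> cspan B" for u v
  proof -
    have "cinner u v = cinner (\<Sum>b\<in>B. cinner u b *\<^sub>C b) v"
      using parseval_in_span[OF assms(1,2) that] by simp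
    then show ?thesis by (simp add: cinner.sum_left cinner_simps)
  qed
  from assms(3) show ?thesis
  proof
    assume "v \<in> cspan B"
    from *[OF this, of u] have "cnj (\<Sum>b\<in>B. cinner v b * cinner b u) = cnj (cinner v u)" by simp
    then show ?thesis
      by (simp add: mult.commute cinner_commute[symmetric])
  qed (rule *)
qed

lemma exists_unit_orthogonal:
  fixes E :: "'a::complex_hilbert set"
  assumes "\<not> (\<exists>B :: 'a set. finite B \<and> cspan B = UNIV)" "finite E"
  obtains v where "norm v = 1" "\<And>e. e \<in> E \<Longrightarrow> cinner v e = 0"
proof -
  obtain B where B: "finite B" "orthonormal_set B" "E \<subseteq> cspan B"
    using gram_schmidt_extend[OF assms(2), of "{}"] by (auto simp: orthonormal_set_def)
  obtain x where x: "x \<notin> cspan B" using assms(1) B(1) by blast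
  obtain B' where B': "B \<subseteq> B'" "finite B'" "orthonormal_set B'" "x \<in> cspan B'"
    using gram_schmidt_extend[of "{x}" B] B by auto
  have "B' \<noteq> B" using x B'(4) by blast
  then obtain v where v: "v \<in> B'" "v \<notin> B" using B'(1) by blast
  have vB: "cinner v b = 0" if "b \<in> B" for b
    using that v B' orthonormal_setD[OF B'(3)] by (metis subsetD)
  have "cinner v e = 0" if "e \<in> cspan B" for e
    using that
    by (induction rule: complex_vector.span_induct_alt) (simp_all add: cinner_simps vB)
  then show ?thesis
    using that[of v] orthonormal_set_norm[OF B'(3) v(1)] B(3) by blast
qed


section \<open>Operators that map one orthonormal sequence to multiples of another\<close>

text \<open>
  Diagonal operators, weighted shifts, unitaries and isometries between basis subsequences are all of
  this form, and so are moduli of compact operators; \<open>schmidt_op_comp\<close> then gives all the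
  products that are needed.
\<close>

definition schmidt_op ::
    "(nat \<Rightarrow> complex) \<Rightarrow> (nat \<Rightarrow> 'a) \<Rightarrow> (nat \<Rightarrow> 'a) \<Rightarrow> 'a::complex_hilbert \<Rightarrow> 'a" where
  "schmidt_op w e f x = (\<Sum>j. (w j * cinner x (e j)) *\<^sub>C f j)"

context
  fixes e f :: "nat \<Rightarrow> 'a::complex_hilbert"
  assumes e: "orthonormal_seq e" and f: "orthonormal_seq f"
begin

lemma
  assumes W: "0 \<le> W" "\<And>j. cinner x (e j) \<noteq> 0 \<Longrightarrow> cmod (w j) \<le> W"
  shows schmidt_op_sums_if_bounded_on_support:
      "(\<lambda>j. (w j * cinner x (e j)) *\<^sub>C f j) sums schmidt_op w e f x"
    and schmidt_op_norm_le: "norm (schmidt_op w e f x) \<le> W * norm x"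
proof -
  have le: "(cmod (w j * cinner x (e j)))\<^sup>2 \<le> W\<^sup>2 * (cmod (cinner x (e j)))\<^sup>2" for j
    using W by (cases "cinner x (e j) = 0")
      (auto simp: norm_mult power_mult_distrib intro!: mult_right_mono power_mono)
  have "summable (\<lambda>j. (cmod (w j * cinner x (e j)))\<^sup>2)"
    by (rule summable_comparison_test'[OF summable_mult[OF bessel_summable[OF e], of "W\<^sup>2" x]])
      (use le in simp)
  from orthonormal_series_summable[OF f this]
  show sums: "(\<lambda>j. (w j * cinner x (e j)) *\<^sub>C f j) sums schmidt_op w e f x"
    unfolding schmidt_op_def by (rule summable_sums)
  have "norm (\<Sum>j<n. (w j * cinner x (e j)) *\<^sub>C f j) \<le> W * norm x" for n
  proof (rule power2_le_imp_le)
    have "(norm (\<Sum>j<n. (w j * cinner x (e j)) *\<^sub>C f j))\<^sup>2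
        \<le> (\<Sum>j<n. W\<^sup>2 * (cmod (cinner x (e j)))\<^sup>2)"
      unfolding norm_orthonormal_sum_squared[OF f finite_lessThan] by (intro sum_mono le)
    also have "\<dots> \<le> W\<^sup>2 * (norm x)\<^sup>2"
      unfolding sum_distrib_left[symmetric] by (intro mult_left_mono bessel[OF e]) auto
    finally show "(norm (\<Sum>j<n. (w j * cinner x (e j)) *\<^sub>C f j))\<^sup>2 \<le> (W * norm x)\<^sup>2"
      by (simp add: power_mult_distrib)
  qed (use W in simp)
  then show "norm (schmidt_op w e f x) \<le> W * norm x"
    using sums unfolding sums_def by (intro LIMSEQ_le_const2[OF tendsto_norm]) auto
qed

context
  fixes w :: "nat \<Rightarrow> complex"
  assumes w: "bounded (range w)"
begin

lemma schmidt_op_sums: "(\<lambda>j. (w j * cinner x (e j)) *\<^sub>C f j) sums schmidt_op w e f x"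
proof -
  obtain W where W: "\<And>j. cmod (w j) \<le> W" using w by (auto simp: bounded_iff)
  have "0 \<le> W" using W[of 0] norm_ge_zero order_trans by blast
  then show ?thesis using schmidt_op_sums_if_bounded_on_support[of W] W by blast
qed

lemma schmidt_op_bounded_clinear: "bounded_clinear (schmidt_op w e f)"
proof -
  obtain W where W: "\<And>j. cmod (w j) \<le> W" using w by (auto simp: bounded_iff)
  have "0 \<le> W" using W[of 0] norm_ge_zero order_trans by blast
  show ?thesis
  proof (rule bounded_clinearI[where K = W])
    fix x y c
    show "schmidt_op w e f (x + y) = schmidt_op w e f x + schmidt_op w e f y"
      using sums_add[OF schmidt_op_sums[of x] schmidt_op_sums[of y]]
        sums_unique2[OF schmidt_op_sums[of "x + y"]]
      by (simp add: cinner_simps scaleC_add_left distrib_left)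
    show "schmidt_op w e f (c *\<^sub>C x) = c *\<^sub>C schmidt_op w e f x"
      using bounded_linear.sums[OF scaleC.bounded_linear_right schmidt_op_sums[of x], of c]
        sums_unique2[OF schmidt_op_sums[of "c *\<^sub>C x"]]
      by (simp add: cinner_simps scaleC_scaleC mult_ac)
    show "norm (schmidt_op w e f x) \<le> W * norm x"
      using schmidt_op_norm_le \<open>0 \<le> W\<close> W by blast
  qed
qed

lemma schmidt_op_cinner: "cinner (schmidt_op w e f x) (f k) = w k * cinner x (e k)"
proof -
  have "(\<lambda>j. cinner ((w j * cinner x (e j)) *\<^sub>C f j) (f k)) sums cinner (schmidt_op w e f x) (f k)"
    by (rule bounded_linear.sums[OF cinner.bounded_linear_left schmidt_op_sums])
  moreover have "(\<lambda>j. cinner ((w j * cinner x (e j)) *\<^sub>C f j) (f k))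
      = (\<lambda>j. if j = k then w k * cinner x (e k) else 0)"
    by (auto simp: cinner_simps orthonormal_seqD[OF f])
  ultimately show ?thesis
    using sums_single[of k "\<lambda>_. w k * cinner x (e k)"] by (simp add: sums_unique2)
qed

lemma schmidt_op_comp:
  "schmidt_op v f h (schmidt_op w e f x) = schmidt_op (\<lambda>j. v j * w j) e h x"
  unfolding schmidt_op_def[of v] schmidt_op_cinner by (simp add: schmidt_op_def mult.assoc)

end

lemma schmidt_op_basis: "schmidt_op w e f (e k) = w k *\<^sub>C f k"
proof -
  have "(\<lambda>j. (w j * cinner (e k) (e j)) *\<^sub>C f j) = (\<lambda>j. if j = k then w k *\<^sub>C f k else 0)"
    by (auto simp: orthonormal_seqD[OF e])
  then show ?thesis
    unfolding schmidt_op_def using sums_single[of k "\<lambda>_. w k *\<^sub>C f k"] by (simp add: sums_unique[symmetric])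
qed

lemma schmidt_op_orthogonal: "(\<And>j. cinner x (e j) = 0) \<Longrightarrow> schmidt_op w e f x = 0"
  by (simp add: schmidt_op_def)

lemma schmidt_op_lincomb:
  assumes "bounded (range v)" "bounded (range w)"
  shows "schmidt_op (\<lambda>j. a * v j + b * w j) e f x
    = a *\<^sub>C schmidt_op v e f x + b *\<^sub>C schmidt_op w e f x"
proof -
  have "(\<lambda>j. a *\<^sub>C ((v j * cinner x (e j)) *\<^sub>C f j) + b *\<^sub>C ((w j * cinner x (e j)) *\<^sub>C f j))
      sums (a *\<^sub>C schmidt_op v e f x + b *\<^sub>C schmidt_op w e f x)"
    by (intro sums_add bounded_linear.sums[OF scaleC.bounded_linear_right] schmidt_op_sums assms)
  moreover have "a *\<^sub>C ((v j * cinner x (e j)) *\<^sub>C f j) + b *\<^sub>C ((w j * cinner x (e j)) *\<^sub>C f j)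
      = ((a * v j + b * w j) * cinner x (e j)) *\<^sub>C f j" for j
    by (simp add: scaleC_scaleC scaleC_add_left distrib_right mult.assoc)
  ultimately show ?thesis
    unfolding schmidt_op_def[of "\<lambda>j. a * v j + b * w j"] by (simp add: sums_unique[symmetric])
qed

end

lemma orthonormal_basis_expansion:
  assumes "orthonormal_basis \<xi>"
  shows "schmidt_op (\<lambda>_. 1) \<xi> \<xi> x = x"
proof -
  have \<xi>: "orthonormal_seq \<xi>" using assms by (rule orthonormal_basis_seq)
  have "schmidt_op (\<lambda>_. 1) \<xi> \<xi> = (\<lambda>x. x)"
  proof (rule bounded_clinear_eq_on_dense[where X = "range \<xi>"])
    show "bounded_clinear (schmidt_op (\<lambda>_. 1) \<xi> \<xi>)"
      by (rule schmidt_op_bounded_clinear[OF \<xi> \<xi>]) simp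
    show "bounded_clinear (\<lambda>x::'a. x)" by (rule bounded_clinearI[where K = 1]) auto
  qed (use assms in \<open>auto simp: orthonormal_basis_def schmidt_op_basis[OF \<xi> \<xi>]\<close>)
  then show ?thesis by simp
qed

text \<open>
  The matrix of \<open>T\<close> in an orthonormal basis gives the adjoint directly: \<open>S y = \<Sum>\<^sub>j \<langle>y, T \<xi>\<^sub>j\<rangle> \<xi>\<^sub>j\<close>.  The partial sums \<open>z\<close> satisfy
  \<open>\<parallel>z\<parallel>\<^sup>2 = \<langle>y, T z\<rangle> \<le> K \<parallel>y\<parallel> \<parallel>z\<parallel>\<close>, which gives both convergence and boundedness.
\<close>

lemma adjoint_exists:
  fixes T :: "'a::complex_hilbert \<Rightarrow> 'a"
  assumes "orthonormal_basis (\<xi> :: nat \<Rightarrow> 'a)" "bounded_clinear T"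
  obtains S where "bounded_clinear S" "\<And>x y. cinner (T x) y = cinner x (S y)"
proof -
  have \<xi>: "orthonormal_seq \<xi>" using assms(1) by (rule orthonormal_basis_seq)
  obtain K where K: "K > 0" "\<And>x. norm (T x) \<le> K * norm x"
    using bounded_clinear_bound[OF assms(2)] by blast
  define c where "c y j = cinner y (T (\<xi> j))" for y j
  define z where "z y n = (\<Sum>j<n. c y j *\<^sub>C \<xi> j)" for y n
  have z_le: "norm (z y n) \<le> K * norm y" for y n
  proof -
    have "cinner y (T (z y n)) = (\<Sum>j<n. cnj (c y j) * c y j)"
      unfolding z_def bounded_clinear_sum[OF assms(2)]
      by (simp add: cinner.sum_right bounded_clinear_scaleC[OF assms(2)] cinner_simps c_def)
    also have "\<dots> = of_real ((norm (z y n))\<^sup>2)"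
      unfolding z_def norm_orthonormal_sum_squared[OF \<xi> finite_lessThan]
      by (simp add: complex_norm_square mult.commute del: of_real_power)
    finally have "(norm (z y n))\<^sup>2 = cmod (cinner y (T (z y n)))"
      by (metis abs_of_nonneg norm_of_real zero_le_power2)
    also have "\<dots> \<le> norm y * (K * norm (z y n))"
      by (rule order_trans[OF norm_cinner_le]) (intro mult_left_mono K norm_ge_zero)
    finally have "norm (z y n) * norm (z y n) \<le> (K * norm y) * norm (z y n)"
      by (simp add: power2_eq_square mult_ac)
    then show ?thesis
      using K(1) by (cases "norm (z y n) = 0") (auto simp: mult_le_cancel_right)
  qed
  have "summable (\<lambda>j. (cmod (c y j))\<^sup>2)" for y
  proof (rule summableI_nonneg_bounded[of _ "(K * norm y)\<^sup>2"])
    show "(\<Sum>j<n. (cmod (c y j))\<^sup>2) \<le> (K * norm y)\<^sup>2" for n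
      using power_mono[OF z_le, of y n 2]
      by (simp add: z_def norm_orthonormal_sum_squared[OF \<xi>])
  qed simp
  then have "summable (\<lambda>j. c y j *\<^sub>C \<xi> j)" for y
    by (rule orthonormal_series_summable[OF \<xi>])
  then have S: "(\<lambda>j. c y j *\<^sub>C \<xi> j) sums (\<Sum>j. c y j *\<^sub>C \<xi> j)" for y
    by (rule summable_sums)
  define S where "S y = (\<Sum>j. c y j *\<^sub>C \<xi> j)" for y
  note S = S[folded S_def]
  have adj: "cinner (T x) y = cinner x (S y)" for x y
  proof -
    have "(\<lambda>j. cinner x (c y j *\<^sub>C \<xi> j)) sums cinner x (S y)"
      by (rule bounded_linear.sums[OF cinner.bounded_linear_right S])
    moreover have "(\<lambda>j. cinner (T (cinner x (\<xi> j) *\<^sub>C \<xi> j)) y) sums cinner (T x) y"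
    proof (rule bounded_linear.sums[OF cinner.bounded_linear_left],
        rule bounded_linear.sums[OF bounded_clinear_bounded_linear[OF assms(2)]])
      show "(\<lambda>j. cinner x (\<xi> j) *\<^sub>C \<xi> j) sums x"
        using schmidt_op_sums[OF \<xi> \<xi>, of "\<lambda>_. 1" x] orthonormal_basis_expansion[OF assms(1), of x]
        by simp
    qed
    moreover have "cinner (T (cinner x (\<xi> j) *\<^sub>C \<xi> j)) y = cinner x (c y j *\<^sub>C \<xi> j)" for j
      using cinner_commute[of "T (\<xi> j)" y]
      by (simp add: bounded_clinear_scaleC[OF assms(2)] cinner_simps c_def mult.commute)
    ultimately show ?thesis by (simp add: sums_unique2)
  qed
  have "bounded_clinear S"
  proof (rule bounded_clinearI[where K = K])
    show "S (x + y) = S x + S y" for x y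
      by (rule cinner_ext) (simp add: cinner_simps adj[symmetric])
    show "S (a *\<^sub>C x) = a *\<^sub>C S x" for a x
      by (rule cinner_ext) (simp add: cinner_simps adj[symmetric])
    show "norm (S y) \<le> K * norm y" for y
      using S[of y] z_le[of y] unfolding sums_def z_def
      by (intro LIMSEQ_le_const2[OF tendsto_norm]) auto
  qed
  then show ?thesis using adj that by blast
qed

lemma cadjoint_eq:
  assumes "\<And>x y. cinner (T x) y = cinner x (S y)"
  shows "cadjoint T = S"
  unfolding cadjoint_def
proof (rule the_equality)
  show "\<forall>x y. cinner (T x) y = cinner x (S y)" using assms by blast
  show "S' = S" if "\<forall>x y. cinner (T x) y = cinner x (S' y)" for S'
    using that assms by (intro ext cinner_ext) metis
qed


section \<open>Singular values of compact operators\<close>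

lemma compact_operator_convergent_subseq:
  assumes "compact_operator T" "\<And>n::nat. norm (x n) \<le> 1"
  obtains r l where "strict_mono r" "(\<lambda>n. T (x (r n))) \<longlonglongrightarrow> l"
proof -
  have "seq_compact (closure (T ` cball 0 1))"
    using assms(1) by (simp add: compact_operator_def compact_imp_seq_compact)
  moreover have "\<forall>n. T (x n) \<in> closure (T ` cball 0 1)"
    using assms(2) by (intro allI set_mp[OF closure_subset] imageI) auto
  ultimately show ?thesis
    using that by (auto elim!: seq_compactE simp: o_def)
qed

text \<open>
  The norm of a compact operator on the orthogonal complement of finitely many eigenvectors of
  \<open>T\<^sup>*T\<close> is attained, at a further eigenvector: for unit vectors \<open>x\<close> of that complement
  with \<open>\<parallel>T x\<parallel>\<close> near the norm \<open>s\<close> one has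
  \<open>\<parallel>T\<^sup>*T x - s\<^sup>2 x\<parallel>\<^sup>2 \<le> s\<^sup>4 - s\<^sup>2 \<parallel>T x\<parallel>\<^sup>2\<close>, so that convergence of \<open>T x\<close> along a sequence
  forces convergence of \<open>x\<close>.
\<close>

lemma norm_attained_on_complement:
  fixes T S :: "'a::complex_hilbert \<Rightarrow> 'a"
  assumes dim: "\<not> (\<exists>B :: 'a set. finite B \<and> cspan B = UNIV)"
    and T: "compact_operator T" and S: "bounded_clinear S"
    and adj: "\<And>x y. cinner (T x) y = cinner x (S y)"
    and E: "finite E" "\<And>e. e \<in> E \<Longrightarrow> \<exists>c. S (T e) = c *\<^sub>C e"
  defines "M \<equiv> {x. \<forall>e\<in>E. cinner x e = 0}"
  obtains v where "v \<in> M" "norm v = 1" "\<And>x. x \<in> M \<Longrightarrow> norm (T x) \<le> norm (T v) * norm x"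
    and "S (T v) = of_real ((norm (T v))\<^sup>2) *\<^sub>C v"
proof -
  have Tb: "bounded_clinear T" using T by (simp add: compact_operator_def)
  obtain K where K: "K > 0" "\<And>x. norm (T x) \<le> K * norm x"
    using bounded_clinear_bound[OF Tb] by blast
  define A where "A = (\<lambda>x. norm (T x)) ` {x \<in> M. norm x = 1}"
  define s where "s = Sup A"
  obtain v0 where "norm v0 = 1" "\<And>e. e \<in> E \<Longrightarrow> cinner v0 e = 0"
    by (rule exists_unit_orthogonal[OF dim E(1)]) (rule that)
  then have v0: "norm v0 = 1" "v0 \<in> M" by (auto simp: M_def)
  have "A \<noteq> {}" using v0 by (auto simp: A_def)
  have bdd: "bdd_above A"
  proof (rule bdd_aboveI[where M = K])
    fix a assume "a \<in> A"
    then obtain x where "a = norm (T x)" "norm x = 1" by (auto simp: A_def)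
    then show "a \<le> K" using K(2)[of x] by simp
  qed
  have s_unit: "norm (T x) \<le> s" if "x \<in> M" "norm x = 1" for x
    unfolding s_def using that by (intro cSup_upper bdd) (auto simp: A_def)
  have "s \<ge> 0" using s_unit[OF v0(2,1)] norm_ge_zero order_trans by blast
  have M_scale: "c *\<^sub>C x \<in> M" if "x \<in> M" for c x
    using that by (simp add: M_def cinner_simps)
  have s_le: "norm (T x) \<le> s * norm x" if "x \<in> M" for x
  proof (cases "x = 0")
    case False
    have "norm (T (of_real (inverse (norm x)) *\<^sub>C x)) \<le> s"
      using False by (intro s_unit M_scale that) (simp add: norm_scaleC norm_inverse)
    then show ?thesis
      using False
      by (simp add: bounded_clinear_scaleC[OF Tb] norm_scaleC norm_inverse norm_divide divide_simps mult.commute)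
  qed (simp add: bounded_clinear_zero[OF Tb])
  have adj': "cinner (S x) y = cinner x (T y)" for x y
    using adj[of y x] by (metis cinner_commute)
  have ST_M: "S (T x) \<in> M" if "x \<in> M" for x
    unfolding M_def
  proof safe
    fix e assume "e \<in> E"
    then obtain c where "S (T e) = c *\<^sub>C e" using E by blast
    then show "cinner (S (T x)) e = 0"
      using that \<open>e \<in> E\<close> by (simp add: adj' adj cinner_simps M_def)
  qed
  have ST_le: "norm (S (T x)) \<le> s * norm (T x)" if "x \<in> M" for x
  proof -
    have "(norm (S (T x)))\<^sup>2 = cmod (cinner (T x) (T (S (T x))))"
      by (simp add: adj'[symmetric] cinner_self norm_power)
    also have "\<dots> \<le> norm (T x) * (s * norm (S (T x)))"
      by (rule order_trans[OF norm_cinner_le]) (intro mult_left_mono s_le ST_M that norm_ge_zero)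
    finally show ?thesis
      using \<open>s \<ge> 0\<close>
      by (cases "S (T x) = 0") (auto simp: power2_eq_square mult_ac mult_le_cancel_left)
  qed
  show ?thesis
  proof (cases "s = 0")
    case True
    then have "T v0 = 0" using s_le[OF v0(2)] by simp
    then show ?thesis
      using that[of v0] v0 s_le True by (simp add: bounded_clinear_zero[OF S])
  next
    case False
    then have "s > 0" using \<open>s \<ge> 0\<close> by simp
    have "\<exists>x\<in>M. norm x = 1 \<and> s - inverse (real (Suc n)) < norm (T x)" for n
    proof -
      have "s - inverse (real (Suc n)) < Sup A" unfolding s_def[symmetric] by simp
      from less_cSupD[OF \<open>A \<noteq> {}\<close> this] show ?thesis unfolding A_def by blast
    qed
    then obtain x where x: "\<And>n. x n \<in> M" "\<And>n. norm (x n) = 1"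
      "\<And>n. s - inverse (real (Suc n)) < norm (T (x n))"
      by metis
    have nT: "(\<lambda>n. norm (T (x n))) \<longlonglongrightarrow> s"
    proof (rule tendsto_sandwich)
      show "(\<lambda>n. s - inverse (real (Suc n))) \<longlonglongrightarrow> s"
        using tendsto_diff[OF tendsto_const LIMSEQ_inverse_real_of_nat, of s] by simp
      show "\<forall>\<^sub>F n in sequentially. s - inverse (real (Suc n)) \<le> norm (T (x n))"
        by (intro always_eventually allI less_imp_le x(3))
      show "\<forall>\<^sub>F n in sequentially. norm (T (x n)) \<le> s"
        by (intro always_eventually allI s_unit x)
    qed simp
    obtain r y where r: "strict_mono r" and y: "(\<lambda>n. T (x (r n))) \<longlonglongrightarrow> y"
      by (rule compact_operator_convergent_subseq[OF T, of x]) (simp add: x(2), rule that)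
    define z where "z n = S (T (x n)) - of_real (s\<^sup>2) *\<^sub>C x n" for n
    have z_le: "(norm (z n))\<^sup>2 \<le> s\<^sup>2 * s\<^sup>2 - s\<^sup>2 * (norm (T (x n)))\<^sup>2" for n
    proof -
      have "cinner (S (T (x n))) (x n) = of_real ((norm (T (x n)))\<^sup>2)"
        by (simp add: adj' cinner_self)
      then have "inner (S (T (x n))) (x n) = (norm (T (x n)))\<^sup>2"
        by (simp add: inner_eq_Re_cinner)
      moreover have "(norm (a - c *\<^sub>R b))\<^sup>2 = (norm a)\<^sup>2 - 2 * c * inner a b + c * c * (norm b)\<^sup>2"
        for a b :: 'a and c
        by (simp add: power2_norm_eq_inner inner_diff inner_commute algebra_simps)
      ultimately have "(norm (z n))\<^sup>2
          = (norm (S (T (x n))))\<^sup>2 - 2 * s\<^sup>2 * (norm (T (x n)))\<^sup>2 + s\<^sup>2 * s\<^sup>2"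
        by (simp only: z_def scaleC_of_real x(2)) simp
      moreover have "(norm (S (T (x n))))\<^sup>2 \<le> s\<^sup>2 * (norm (T (x n)))\<^sup>2"
        using power_mono[OF ST_le[OF x(1)], of n 2] by (simp add: power_mult_distrib)
      ultimately show ?thesis by simp
    qed
    have bound: "(\<lambda>n. s\<^sup>2 * s\<^sup>2 - s\<^sup>2 * (norm (T (x n)))\<^sup>2) \<longlonglongrightarrow> s\<^sup>2 * s\<^sup>2 - s\<^sup>2 * s\<^sup>2"
      by (intro tendsto_intros nT)
    have "(\<lambda>n. (norm (z n))\<^sup>2) \<longlonglongrightarrow> 0"
    proof (rule tendsto_sandwich[OF _ _ tendsto_const])
      show "(\<lambda>n. s\<^sup>2 * s\<^sup>2 - s\<^sup>2 * (norm (T (x n)))\<^sup>2) \<longlonglongrightarrow> 0" using bound by simp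
      show "\<forall>\<^sub>F n in sequentially. (norm (z n))\<^sup>2 \<le> s\<^sup>2 * s\<^sup>2 - s\<^sup>2 * (norm (T (x n)))\<^sup>2"
        by (intro always_eventually allI z_le)
    qed simp
    from tendsto_real_sqrt[OF this] have "z \<longlonglongrightarrow> 0"
      by (intro tendsto_norm_zero_cancel[of z]) simp
    then have zr: "(\<lambda>n. z (r n)) \<longlonglongrightarrow> 0"
      using LIMSEQ_subseq_LIMSEQ[OF _ r] by (auto simp: o_def)
    define v where "v = of_real (inverse (s\<^sup>2)) *\<^sub>C S y"
    have "(\<lambda>n. complex_of_real (inverse (s\<^sup>2)) *\<^sub>C (S (T (x (r n))) - z (r n)))
        \<longlonglongrightarrow> complex_of_real (inverse (s\<^sup>2)) *\<^sub>C (S y - 0)"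
      by (intro scaleC.tendsto tendsto_intros zr bounded_clinear_tendsto[OF S] y)
    moreover have "complex_of_real (inverse (s\<^sup>2)) *\<^sub>C (S (T (x (r n))) - z (r n)) = x (r n)" for n
      using \<open>s > 0\<close> by (simp add: z_def scaleC_scaleC flip: of_real_mult of_real_power)
    ultimately have xv: "(\<lambda>n. x (r n)) \<longlonglongrightarrow> v" by (simp add: v_def)
    have "v \<in> M"
      unfolding M_def
    proof safe
      fix e assume "e \<in> E"
      then have "(\<lambda>n. cinner (x (r n)) e) = (\<lambda>n. 0)" using x(1) by (auto simp: M_def)
      moreover have "(\<lambda>n. cinner (x (r n)) e) \<longlonglongrightarrow> cinner v e"
        by (intro cinner.tendsto xv tendsto_const)
      ultimately show "cinner v e = 0" by (simp add: LIMSEQ_const_iff)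
    qed
    moreover have "norm v = 1"
      using tendsto_norm[OF xv] x(2) by (simp add: LIMSEQ_const_iff)
    moreover have Tv: "T v = y"
      using bounded_clinear_tendsto[OF Tb xv] y LIMSEQ_unique by blast
    moreover have ny: "norm y = s"
      using tendsto_norm[OF y] LIMSEQ_subseq_LIMSEQ[OF nT r] LIMSEQ_unique by (force simp: o_def)
    moreover have "S (T v) = of_real ((norm (T v))\<^sup>2) *\<^sub>C v"
      unfolding Tv ny
      using \<open>s > 0\<close> by (simp add: v_def scaleC_scaleC flip: of_real_mult of_real_power)
    ultimately show ?thesis using that s_le by simp
  qed
qed

text \<open>
  The output of the singular value decomposition of \<open>T\<close>: the vectors \<open>e\<^sub>n\<close> are eigenvectors of
  \<open>T\<^sup>*T\<close> with eigenvalues \<open>s\<^sub>n\<^sup>2\<close>, and the last clause says that nothing is left out.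
\<close>

definition singular_system ::
    "('a::complex_hilbert \<Rightarrow> 'a) \<Rightarrow> (nat \<Rightarrow> 'a) \<Rightarrow> (nat \<Rightarrow> real) \<Rightarrow> bool" where
  "singular_system T e s \<longleftrightarrow> orthonormal_seq e \<and> decseq s \<and> s \<longlonglongrightarrow> 0 \<and>
     (\<forall>n. s n = norm (T (e n))) \<and>
     (\<forall>n. cadjoint T (T (e n)) = of_real ((s n)\<^sup>2) *\<^sub>C e n) \<and>
     (\<forall>n x. (\<forall>i<n. cinner x (e i) = 0) \<longrightarrow> norm (T x) \<le> s n * norm x)"

text \<open>
  Each \<open>e\<^sub>n\<close> is a maximizing vector on the complement of its predecessors.  The images
  \<open>T e\<^sub>n\<close> are orthogonal to each other, so \<open>s\<^sub>n \<ge> L > 0\<close> for all \<open>n\<close> would keep them at mutual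
  distance at least \<open>L\<close> and contradict compactness.
\<close>

lemma singular_system_exists:
  fixes T S :: "'a::complex_hilbert \<Rightarrow> 'a"
  assumes dim: "\<not> (\<exists>B :: 'a set. finite B \<and> cspan B = UNIV)"
    and T: "compact_operator T" and S: "bounded_clinear S"
    and adj: "\<And>x y. cinner (T x) y = cinner x (S y)"
  obtains e s where "singular_system T e s"
proof -
  define Q where "Q f n v \<longleftrightarrow> norm v = 1 \<and> (\<forall>i<n. cinner v (f i) = 0) \<and>
      (\<forall>x. (\<forall>i<n. cinner x (f i) = 0) \<longrightarrow> norm (T x) \<le> norm (T v) * norm x) \<and>
      S (T v) = of_real ((norm (T v))\<^sup>2) *\<^sub>C v" for f :: "nat \<Rightarrow> 'a" and n :: nat and v
  have "\<exists>e. \<forall>n. Q e n (e n)"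
  proof (rule dependent_wf_choice[of less_than])
    fix n :: nat and f assume "\<And>i. (i, n) \<in> less_than \<Longrightarrow> Q f i (f i)"
    then have eig: "\<exists>c. S (T v) = c *\<^sub>C v" if "v \<in> f ` {..<n}" for v
      using that unfolding Q_def by auto
    obtain v where v: "v \<in> {x. \<forall>y\<in>f ` {..<n}. cinner x y = 0}" "norm v = 1"
      "\<And>x. x \<in> {x. \<forall>y\<in>f ` {..<n}. cinner x y = 0} \<Longrightarrow> norm (T x) \<le> norm (T v) * norm x"
      "S (T v) = of_real ((norm (T v))\<^sup>2) *\<^sub>C v"
      by (rule norm_attained_on_complement[OF dim T S adj finite_imageI[OF finite_lessThan] eig])
        (assumption, rule that)
    show "\<exists>v. Q f n v"
      unfolding Q_def by (rule exI[of _ v]) (use v in auto)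
  qed (simp_all add: Q_def)
  then obtain e where e: "\<And>n. Q e n (e n)" by blast
  define s where "s n = norm (T (e n))" for n
  have tail: "norm (T x) \<le> s n * norm x" if "\<forall>i<n. cinner x (e i) = 0" for n x
    using e[of n] that by (simp add: Q_def s_def)
  have STe: "S (T (e n)) = of_real ((s n)\<^sup>2) *\<^sub>C e n" for n
    using e[of n] by (simp add: Q_def s_def)
  have ne: "norm (e n) = 1" for n using e[of n] by (simp add: Q_def)
  have ons: "orthonormal_seq e"
    unfolding orthonormal_seq_def
  proof safe
    fix i j
    have "cinner (e i) (e j) = 0" if "j < i" for i j
      using e[of i] that by (simp add: Q_def)
    then show "cinner (e i) (e j) = (if i = j then 1 else 0)"
      using cinner_eq_0_sym[of "e j" "e i"] by (auto simp: cinner_self ne neq_iff)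
  qed
  have dec: "decseq s"
  proof (rule decseq_SucI)
    show "s (Suc n) \<le> s n" for n
      using tail[of n "e (Suc n)"] ons by (simp add: s_def[symmetric] ne orthonormal_seq_def)
  qed
  have "s \<longlonglongrightarrow> 0"
  proof -
    obtain L where L: "s \<longlonglongrightarrow> L" "\<And>n. L \<le> s n"
      using decseq_convergent[OF dec, of 0] by (auto simp: s_def)
    have "L \<ge> 0" using L(1) by (rule LIMSEQ_le_const) (simp add: s_def)
    obtain r y where r: "strict_mono r" and y: "(\<lambda>n. T (e (r n))) \<longlonglongrightarrow> y"
      by (rule compact_operator_convergent_subseq[OF T, of e]) (simp add: ne, rule that)
    have lim: "(\<lambda>n. (norm (T (e (r (Suc n))) + (- T (e (r n)))))\<^sup>2) \<longlonglongrightarrow> (norm (y + (- y)))\<^sup>2"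
      by (intro tendsto_intros y LIMSEQ_Suc[OF y])
    have ge: "L\<^sup>2 \<le> (norm (T (e (r (Suc n))) + (- T (e (r n)))))\<^sup>2" for n
    proof -
      have "r (Suc n) \<noteq> r n" using r by (simp add: strict_mono_eq)
      then have "cinner (T (e (r (Suc n)))) (- T (e (r n))) = 0"
        using orthonormal_seqD[OF ons]
        by (simp add: adj STe cinner.minus_right cinner_simps)
      then have "(norm (T (e (r (Suc n))) + (- T (e (r n)))))\<^sup>2 = (s (r (Suc n)))\<^sup>2 + (s (r n))\<^sup>2"
        by (subst norm_add_squared_orthogonal) (simp_all add: s_def)
      moreover have "L\<^sup>2 \<le> (s (r n))\<^sup>2" using L(2) \<open>L \<ge> 0\<close> by (intro power_mono) auto
      ultimately show ?thesis by (simp add: add_increasing)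
    qed
    have "L\<^sup>2 \<le> (norm (y + (- y)))\<^sup>2"
      by (rule LIMSEQ_le_const[OF lim]) (use ge in blast)
    then show ?thesis using L(1) by simp
  qed
  then have "singular_system T e s"
    using ons dec tail STe cadjoint_eq[of T S, OF adj] by (simp add: singular_system_def s_def)
  then show ?thesis by (rule that)
qed

text \<open>Polarization of the real-valued form \<open>\<langle>P x, x\<rangle>\<close>.\<close>

lemma positive_operator_selfadjoint:
  assumes "positive_operator P"
  shows "cinner (P x) y = cinner x (P y)"
proof -
  have P: "bounded_clinear P" using assms by (simp add: positive_operator_def)
  define q where "q x y = cinner (P x) y - cinner x (P y)" for x y
  have q0: "q x x = 0" for x
  proof -
    have "cinner (P x) x \<in> \<real>\<^sub>\<ge>\<^sub>0" using assms by (simp add: positive_operator_def)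
    then have "cnj (cinner (P x) x) = cinner (P x) x"
      by (auto elim: nonneg_Reals_cases)
    then show ?thesis by (metis cinner_commute q_def right_minus_eq)
  qed
  note q_simps = q_def bounded_clinear_add[OF P] bounded_clinear_scaleC[OF P] cinner_simps
  have "q x y + q y x = 0"
    using q0[of "x + y"] q0[of x] q0[of y] by (simp add: q_simps algebra_simps)
  moreover have "\<i> * (q y x - q x y) = 0"
    using q0[of "x + \<i> *\<^sub>C y"] q0[of x] q0[of y] by (simp add: q_simps algebra_simps)
  ultimately have "q x y = 0" by simp
  then show ?thesis by (simp add: q_def)
qed

text \<open>Positivity enters through the kernel of \<open>P + t\<close>, which is trivial for \<open>t > 0\<close>.\<close>

lemma positive_operator_root_eigenvector:
  assumes P: "positive_operator P" and x: "P (P x) = of_real (t\<^sup>2) *\<^sub>C x" and "t \<ge> 0"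
  shows "P x = of_real t *\<^sub>C x"
proof (cases "t = 0")
  case True
  then have "cinner (P x) (P x) = 0"
    using x positive_operator_selfadjoint[OF P, of "P x" x] by simp
  then show ?thesis using True by simp
next
  case False
  have Pb: "bounded_clinear P" using P by (simp add: positive_operator_def)
  define y where "y = P x - of_real t *\<^sub>C x"
  have "P y = - (of_real t *\<^sub>C y)"
    using x by (simp add: y_def bounded_clinear_diff[OF Pb] bounded_clinear_scaleC[OF Pb]
        scaleC.diff_right scaleC_scaleC power2_eq_square)
  then have "cinner (P y) y = - of_real (t * (norm y)\<^sup>2)"
    by (simp add: cinner.minus_left cinner_simps cinner_self)
  moreover have "cinner (P y) y \<in> \<real>\<^sub>\<ge>\<^sub>0" using P by (simp add: positive_operator_def)
  ultimately have "t * (norm y)\<^sup>2 \<le> 0"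
    by (metis nonneg_Reals_of_real_iff of_real_minus neg_0_le_iff_le)
  then show ?thesis
    using False \<open>t \<ge> 0\<close> by (simp add: y_def mult_le_0_iff)
qed

text \<open>
  The difficulty is the uniqueness of the positive square root of \<open>T\<^sup>*T\<close>.  Any such root \<open>R\<close>
  multiplies \<open>e\<^sub>n\<close> by \<open>s\<^sub>n\<close> and kills the orthogonal complement of all \<open>e\<^sub>n\<close>, because these are
  eigenvectors of \<open>R\<^sup>2\<close>; hence it is determined everywhere.
\<close>

lemma abs_operator_eq_schmidt_op:
  fixes T S :: "'a::complex_hilbert \<Rightarrow> 'a"
  assumes T: "bounded_clinear T" and S: "bounded_clinear S"
    and adj: "\<And>x y. cinner (T x) y = cinner x (S y)"
    and sys: "singular_system T e s"
  shows "abs_operator T = schmidt_op (\<lambda>n. of_real (s n)) e e"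
proof -
  have ons: "orthonormal_seq e" and s0: "s \<longlonglongrightarrow> 0" and s_nonneg: "\<And>n. s n \<ge> 0"
    and STe: "\<And>n. S (T (e n)) = of_real ((s n)\<^sup>2) *\<^sub>C e n"
    and tail: "\<And>n x. \<forall>i<n. cinner x (e i) = 0 \<Longrightarrow> norm (T x) \<le> s n * norm x"
    using sys cadjoint_eq[of T S, OF adj] by (auto simp: singular_system_def)
  have Bs: "bounded (range (\<lambda>n. complex_of_real (s n)))"
    by (rule convergent_imp_bounded[of _ "of_real 0"]) (intro tendsto_of_real s0)
  define P where "P = schmidt_op (\<lambda>n. complex_of_real (s n)) e e"
  have PP: "P (P x) = schmidt_op (\<lambda>n. of_real ((s n)\<^sup>2)) e e x" for x
    unfolding P_def by (simp add: schmidt_op_comp[OF ons ons Bs] power2_eq_square)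
  have ST: "S (T x) = schmidt_op (\<lambda>n. of_real ((s n)\<^sup>2)) e e x" for x
  proof -
    define p where "p n = (\<Sum>i<n. cinner x (e i) *\<^sub>C e i)" for n
    have "(\<lambda>n. T (x - p n)) \<longlonglongrightarrow> 0"
    proof (rule Lim_null_comparison)
      show "\<forall>\<^sub>F n in sequentially. norm (T (x - p n)) \<le> s n * norm x"
      proof (intro always_eventually allI)
        fix n
        have "norm (T (x - p n)) \<le> s n * norm (x - p n)"
          using projection_remainder(1)[OF ons, of "{..<n}"] by (intro tail) (simp add: p_def)
        also have "\<dots> \<le> s n * norm x"
          unfolding p_def by (intro mult_left_mono norm_projection_remainder_le ons s_nonneg) auto
        finally show "norm (T (x - p n)) \<le> s n * norm x" .
      qed
      show "(\<lambda>n. s n * norm x) \<longlonglongrightarrow> 0" using tendsto_mult_left_zero[OF s0] .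
    qed
    then have "(\<lambda>n. S (T x - T (x - p n))) \<longlonglongrightarrow> S (T x - 0)"
      by (intro bounded_clinear_tendsto[OF S] tendsto_diff tendsto_const)
    then have "(\<lambda>n. S (T (p n))) \<longlonglongrightarrow> S (T x)"
      by (simp add: bounded_clinear_diff[OF T])
    moreover have "S (T (p n)) = (\<Sum>i<n. (of_real ((s i)\<^sup>2) * cinner x (e i)) *\<^sub>C e i)" for n
      by (simp add: p_def bounded_clinear_sum[OF T] bounded_clinear_sum[OF S] STe scaleC_scaleC
          bounded_clinear_scaleC[OF T] bounded_clinear_scaleC[OF S] mult.commute)
    ultimately have "(\<lambda>i. (of_real ((s i)\<^sup>2) * cinner x (e i)) *\<^sub>C e i) sums S (T x)"
      by (simp add: sums_def)
    then show ?thesis by (simp add: schmidt_op_def sums_unique)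
  qed
  have P: "positive_operator P"
    unfolding positive_operator_def
  proof safe
    show Pb: "bounded_clinear P" unfolding P_def by (rule schmidt_op_bounded_clinear[OF ons ons Bs])
    fix x
    have "(\<lambda>n. cinner ((of_real (s n) * cinner x (e n)) *\<^sub>C e n) x) sums cinner (P x) x"
      unfolding P_def
      by (rule bounded_linear.sums[OF cinner.bounded_linear_left schmidt_op_sums[OF ons ons Bs]])
    moreover have "cinner ((of_real (s n) * cinner x (e n)) *\<^sub>C e n) x
        = of_real (s n * (cmod (cinner x (e n)))\<^sup>2)" for n
      using complex_norm_square[of "cinner x (e n)"] cinner_commute[of "e n" x]
      by (simp add: cinner_simps)
    ultimately have *: "(\<lambda>n. complex_of_real (s n * (cmod (cinner x (e n)))\<^sup>2)) sums cinner (P x) x"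
      by simp
    have "Re (cinner (P x) x) \<ge> 0"
      by (rule sums_le[OF _ sums_zero sums_Re[OF *]]) (simp add: s_nonneg)
    moreover from sums_Im[OF *] have "Im (cinner (P x) x) = 0" by (simp add: sums_iff)
    ultimately show "cinner (P x) x \<in> \<real>\<^sub>\<ge>\<^sub>0" by (simp add: complex_nonneg_Reals_iff)
  qed
  have uniq: "R = P" if R: "positive_operator R" "R \<circ> R = S \<circ> T" for R
  proof
    fix x
    have Rb: "bounded_clinear R" using R(1) by (simp add: positive_operator_def)
    have RR: "R (R x) = S (T x)" for x using R(2) by (metis comp_apply)
    have Re: "R (e n) = of_real (s n) *\<^sub>C e n" for n
      by (rule positive_operator_root_eigenvector[OF R(1) _ s_nonneg]) (simp add: RR STe)
    define q where "q = schmidt_op (\<lambda>_. 1) e e x"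
    have orth: "cinner (x - q) (e n) = 0" for n
      unfolding q_def by (simp add: cinner_simps schmidt_op_cinner[OF ons ons])
    have "R (R (x - q)) = of_real (0\<^sup>2) *\<^sub>C (x - q)"
      using schmidt_op_orthogonal[OF ons ons orth] by (simp add: RR ST)
    then have "R (x - q) = 0"
      using positive_operator_root_eigenvector[OF R(1), of "x - q" 0] by simp
    moreover have "R q = P x"
    proof -
      have "(\<lambda>n. R ((1 * cinner x (e n)) *\<^sub>C e n)) sums R q"
        unfolding q_def
        by (intro bounded_linear.sums[OF bounded_clinear_bounded_linear[OF Rb]]
            schmidt_op_sums[OF ons ons]) simp
      moreover have "R ((1 * cinner x (e n)) *\<^sub>C e n) = (of_real (s n) * cinner x (e n)) *\<^sub>C e n" for n
        by (simp add: bounded_clinear_scaleC[OF Rb] Re scaleC_scaleC mult.commute)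
      ultimately show ?thesis by (simp add: P_def schmidt_op_def sums_iff)
    qed
    ultimately show "R x = P x" by (simp add: bounded_clinear_diff[OF Rb])
  qed
  have "(THE P. positive_operator P \<and> P \<circ> P = S \<circ> T) = P"
  proof (rule the_equality)
    show "positive_operator P \<and> P \<circ> P = S \<circ> T" using P PP ST by (simp add: fun_eq_iff)
  qed (use uniq in blast)
  then have "(THE P. positive_operator P \<and> P \<circ> P = cadjoint T \<circ> T) = P"
    by (simp only: cadjoint_eq[of T S, OF adj])
  then show ?thesis by (simp add: abs_operator_def P_def)
qed

text \<open>
  Comparing coefficients, an eigenvector at \<open>t > 0\<close> is a combination of those \<open>e\<^sub>k\<close> with
  \<open>s\<^sub>k = t\<close>, of which there are finitely many.
\<close>

lemma eigenspace_schmidt_op: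
  assumes ons: "orthonormal_seq e" and s0: "s \<longlonglongrightarrow> 0" and "t > 0"
  shows "cdim {x. schmidt_op (\<lambda>n. complex_of_real (s n)) e e x = t *\<^sub>R x} = card {j. s j = t}"
proof -
  define J where "J = {j. s j = t}"
  have "finite J"
  proof -
    obtain N where "\<And>n. n \<ge> N \<Longrightarrow> s n < t"
      using order_tendstoD(2)[OF s0 \<open>t > 0\<close>] by (auto simp: eventually_sequentially)
    then have "J \<subseteq> {..<N}" by (force simp: J_def not_less[symmetric])
    then show ?thesis using finite_subset by blast
  qed
  have Bs: "bounded (range (\<lambda>n. complex_of_real (s n)))"
    by (rule convergent_imp_bounded[of _ "of_real 0"]) (intro tendsto_of_real s0)
  define P where "P = schmidt_op (\<lambda>n. complex_of_real (s n)) e e"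
  have Pb: "bounded_clinear P" unfolding P_def by (rule schmidt_op_bounded_clinear[OF ons ons Bs])
  have "{x. P x = t *\<^sub>R x} = cspan (e ` J)"
  proof safe
    fix x assume x: "P x = t *\<^sub>R x"
    have "cinner x (e k) = 0 \<or> t = s k" for k
      using schmidt_op_cinner[OF ons ons Bs, of x k] x
      by (simp add: P_def cinner.scaleR_left scaleR_conv_of_real)
    then have *: "of_real (s k) * cinner x (e k) = (if k \<in> J then of_real t * cinner x (e k) else 0)" for k
      by (force simp: J_def)
    have "P x = (\<Sum>k. (if k \<in> J then (of_real t * cinner x (e k)) *\<^sub>C e k else 0))"
      unfolding P_def schmidt_op_def by (intro arg_cong[where f = suminf]) (auto simp: *)
    also have "\<dots> = (\<Sum>k\<in>J. (of_real t * cinner x (e k)) *\<^sub>C e k)"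
      using suminf_finite[OF \<open>finite J\<close>, of "\<lambda>k. if k \<in> J then (of_real t * cinner x (e k)) *\<^sub>C e k else 0"]
      by simp
    finally have "P x \<in> cspan (e ` J)"
      by (simp add: complex_vector.span_sum complex_vector.span_scale complex_vector.span_base)
    then have "complex_of_real (inverse t) *\<^sub>C P x \<in> cspan (e ` J)"
      by (rule complex_vector.span_scale)
    then show "x \<in> cspan (e ` J)" using x \<open>t > 0\<close> by (simp only: scaleC_of_real) simp
  next
    fix x assume "x \<in> cspan (e ` J)"
    then show "P x = t *\<^sub>R x"
    proof (induction rule: complex_vector.span_induct_alt)
      case base
      then show ?case by (simp add: bounded_clinear_zero[OF Pb])
    next
      case (step c x y)
      then obtain j where j: "x = e j" "s j = t" by (auto simp: J_def)
      then have "P x = t *\<^sub>R x" by (simp add: P_def schmidt_op_basis[OF ons ons] scaleC_of_real)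
      with step show ?case
        by (simp add: bounded_clinear_add[OF Pb] bounded_clinear_scaleC[OF Pb] scaleR_add_right
            scaleC.scaleR_right)
    qed
  qed
  moreover have "complex_vector.independent (e ` J)"
    unfolding complex_vector.independent_explicit_finite_subsets
  proof safe
    fix B u b assume B: "B \<subseteq> e ` J" "finite B" "(\<Sum>v\<in>B. u v *\<^sub>C v) = 0" "b \<in> B"
    have oB: "orthonormal_set B"
      using orthonormal_setD[OF orthonormal_seq_image[OF ons, of J]] B(1)
      unfolding orthonormal_set_def by blast
    have "cinner (\<Sum>v\<in>B. u v *\<^sub>C v) b = u b"
      by (simp add: cinner.sum_left cinner_simps sum_orthonormal_set[OF oB B(2,4)])
    then show "u b = 0" using B(3) by simp
  qed
  ultimately have "cdim {x. P x = t *\<^sub>R x} = card (e ` J)"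
    by (simp add: complex_vector.dim_eq_card_independent complex_vector.dim_span)
  also have "\<dots> = card J"
    by (rule card_image) (use orthonormal_seq_inj[OF ons] in \<open>auto intro: inj_on_subset\<close>)
  finally show ?thesis by (simp add: P_def J_def)
qed

text \<open>
  At the first index where the sequences differ, the larger of the two values occurs more often in
  the sequence that has it there, since in the other one it can occur only earlier.
\<close>

lemma decseq_eq_if_multiplicities_eq:
  fixes \<mu> \<nu> :: "nat \<Rightarrow> real"
  assumes \<mu>: "decseq \<mu>" "\<mu> \<longlonglongrightarrow> 0" and \<nu>: "decseq \<nu>" "\<nu> \<longlonglongrightarrow> 0"
    and mult: "\<And>s. s > 0 \<Longrightarrow> card {j. \<mu> j = s} = card {j. \<nu> j = s}"
  shows "\<mu> = \<nu>"
proof -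
  have le: "\<mu> j \<le> \<nu> j"
    if eq: "\<And>i. i < j \<Longrightarrow> \<mu> i = \<nu> i" and \<mu>: "decseq \<mu>" "\<mu> \<longlonglongrightarrow> 0" and \<nu>: "decseq \<nu>" "\<nu> \<longlonglongrightarrow> 0"
      and mult: "\<And>s. s > 0 \<Longrightarrow> card {j. \<mu> j = s} = card {j. \<nu> j = s}"
    for j and \<mu> \<nu> :: "nat \<Rightarrow> real"
  proof (rule ccontr)
    assume "\<not> \<mu> j \<le> \<nu> j"
    then have gt: "\<mu> j > \<nu> j" by simp
    have pos: "\<mu> j > 0" using gt decseq_ge[OF \<nu>, of j] by linarith
    have fin: "finite {i. \<mu> i = \<mu> j}"
    proof -
      obtain N where "\<And>n. n \<ge> N \<Longrightarrow> \<mu> n < \<mu> j"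
        using order_tendstoD(2)[OF \<mu>(2) pos] by (auto simp: eventually_sequentially)
      then have "{i. \<mu> i = \<mu> j} \<subseteq> {..<N}" by (force simp: not_less[symmetric])
      then show ?thesis using finite_subset by blast
    qed
    have "{i. \<nu> i = \<mu> j} \<subseteq> {i. \<mu> i = \<mu> j} - {j}"
    proof safe
      fix i assume i: "\<nu> i = \<mu> j"
      then have "i < j" using gt decseqD[OF \<nu>(1), of j i] by (force simp: not_less[symmetric])
      then show "\<mu> i = \<mu> j" using eq i by simp
    qed (use gt in simp)
    then have "card {i. \<nu> i = \<mu> j} \<le> card ({i. \<mu> i = \<mu> j} - {j})"
      using fin by (intro card_mono) auto
    also have "\<dots> < card {i. \<mu> i = \<mu> j}"
      using fin by (intro card_Diff1_less) auto
    finally show False using mult[OF pos] by simp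
  qed
  have "\<mu> j = \<nu> j" for j
  proof (induction j rule: less_induct)
    case (less j)
    show ?case
      using le[of j \<mu> \<nu>] le[of j \<nu> \<mu>] less assms by force
  qed
  then show ?thesis by auto
qed

lemma singular_value_eq:
  fixes T S :: "'a::complex_hilbert \<Rightarrow> 'a"
  assumes "bounded_clinear T" "bounded_clinear S" "\<And>x y. cinner (T x) y = cinner x (S y)"
    and sys: "singular_system T e s"
  shows "singular_value T = s"
proof -
  have s: "orthonormal_seq e" "decseq s" "s \<longlonglongrightarrow> 0" using sys by (auto simp: singular_system_def)
  have dims: "cdim {x. abs_operator T x = t *\<^sub>R x} = card {j. s j = t}" if "t > 0" for t
    using abs_operator_eq_schmidt_op[OF assms] eigenspace_schmidt_op[OF s(1,3) that] by simp
  show ?thesis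
    unfolding singular_value_def
  proof (rule the_equality)
    fix \<mu> :: "nat \<Rightarrow> real"
    assume "decseq \<mu> \<and> \<mu> \<longlonglongrightarrow> 0 \<and> (\<forall>t>0. card {j. \<mu> j = t} = cdim {x. abs_operator T x = t *\<^sub>R x})"
    then show "\<mu> = s" using s dims by (intro decseq_eq_if_multiplicities_eq) auto
  qed (use s dims in auto)
qed


section \<open>The weak Lorentz ideal in terms of finite-rank approximation\<close>

text \<open>Fewer equations than unknowns: elimination of one unknown by one equation.\<close>

lemma homogeneous_system_solvable:
  fixes a :: "'i \<Rightarrow> 'k \<Rightarrow> 'f::field"
  assumes "finite K" "finite I" "card K < card I"
  shows "\<exists>c. (\<exists>i\<in>I. c i \<noteq> 0) \<and> (\<forall>k\<in>K. (\<Sum>i\<in>I. c i * a i k) = 0)"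
  using assms
proof (induction K arbitrary: I a)
  case empty
  then obtain i where "i \<in> I" by fastforce
  then show ?case by (intro exI[of _ "\<lambda>_. 1"]) auto
next
  case (insert k K)
  show ?case
  proof (cases "\<forall>i\<in>I. a i k = 0")
    case True
    have "card K < card I" using insert.prems insert.hyps by simp
    from insert.IH[OF insert.prems(1) this, of a] True show ?thesis by auto
  next
    case False
    then obtain p where p: "p \<in> I" "a p k \<noteq> 0" by blast
    define b where "b i l = a i l - a i k / a p k * a p l" for i l
    have "card K < card (I - {p})" using insert.prems insert.hyps p by simp
    from insert.IH[of "I - {p}" b] this insert.prems obtain c
      where c: "\<exists>i\<in>I - {p}. c i \<noteq> 0" "\<And>l. l \<in> K \<Longrightarrow> (\<Sum>i\<in>I - {p}. c i * b i l) = 0"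
      by auto
    define d where "d = c(p := - (\<Sum>i\<in>I - {p}. c i * a i k) / a p k)"
    have split: "(\<Sum>i\<in>I. d i * a i l) = (\<Sum>i\<in>I - {p}. c i * b i l)" for l
    proof -
      have "(\<Sum>i\<in>I. d i * a i l) = d p * a p l + (\<Sum>i\<in>I - {p}. d i * a i l)"
        using p insert.prems by (simp add: sum.remove)
      also have "(\<Sum>i\<in>I - {p}. d i * a i l) = (\<Sum>i\<in>I - {p}. c i * a i l)"
        by (intro sum.cong) (auto simp: d_def)
      also have "d p * a p l = - (\<Sum>i\<in>I - {p}. c i * (a i k / a p k * a p l))"
        by (simp add: d_def sum_distrib_right sum_divide_distrib mult.assoc)
      finally show ?thesis by (simp add: b_def right_diff_distrib sum_subtractf)
    qed
    have "(\<Sum>i\<in>I. d i * a i k) = 0" using p(2) by (simp add: split b_def)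
    then have "\<forall>l\<in>insert k K. (\<Sum>i\<in>I. d i * a i l) = 0" using c(2) by (simp add: split)
    moreover have "\<exists>i\<in>I. d i \<noteq> 0" using c(1) by (auto simp: d_def)
    ultimately show ?thesis by blast
  qed
qed

text \<open>
  The easy half of the min-max principle: the span of \<open>e\<^sub>0, \<dots>, e\<^sub>n\<close>, on which \<open>T\<close> expands by at
  least \<open>s\<^sub>n\<close>, contains a nonzero vector in the kernel of the approximating operator.
\<close>

lemma singular_system_le_approximation_error:
  assumes T: "bounded_clinear T" and adj: "\<And>x y. cinner (T x) y = cinner x (cadjoint T y)"
    and sys: "singular_system T e s"
    and err: "\<And>x. norm (T x - (\<Sum>i<n. cinner x (u i) *\<^sub>C v i)) \<le> K * norm x"
  shows "s n \<le> K"
proof -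
  have ons: "orthonormal_seq e" and dec: "decseq s" and nT: "\<And>n. norm (T (e n)) = s n"
    and STe: "\<And>n. cadjoint T (T (e n)) = of_real ((s n)\<^sup>2) *\<^sub>C e n"
    using sys by (auto simp: singular_system_def)
  have s_nonneg: "s i \<ge> 0" for i using nT[of i] norm_ge_zero by metis
  obtain c where c: "\<exists>i\<in>{..n}. c i \<noteq> 0"
    "\<forall>k\<in>{..<n}. (\<Sum>i\<in>{..n}. c i * cinner (e i) (u k)) = 0"
    using homogeneous_system_solvable[of "{..<n}" "{..n}" "\<lambda>i k. cinner (e i) (u k)"] by auto
  define x where "x = (\<Sum>i\<le>n. c i *\<^sub>C e i)"
  have "cinner x (u k) = 0" if "k < n" for k
    using c(2) that by (simp add: x_def cinner.sum_left cinner_simps)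
  then have Tx_le: "norm (T x) \<le> K * norm x" using err[of x] by simp
  have nx: "(norm x)\<^sup>2 = (\<Sum>i\<le>n. (cmod (c i))\<^sup>2)"
    unfolding x_def by (rule norm_orthonormal_sum_squared[OF ons]) simp
  obtain i0 where "i0 \<le> n" "c i0 \<noteq> 0" using c(1) by auto
  then have "(norm x)\<^sup>2 > 0"
    unfolding nx by (intro sum_pos2[of _ i0]) auto
  then have "norm x > 0" by simp
  have "(s n * norm x)\<^sup>2 = (\<Sum>i\<le>n. (s n)\<^sup>2 * (cmod (c i))\<^sup>2)"
    by (simp add: power_mult_distrib nx sum_distrib_left)
  also have "\<dots> \<le> (\<Sum>i\<le>n. (s i)\<^sup>2 * (cmod (c i))\<^sup>2)"
    by (intro sum_mono mult_right_mono power_mono) (auto intro: decseqD[OF dec] s_nonneg)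
  also have "\<dots> = (\<Sum>i\<le>n. (norm (c i *\<^sub>C T (e i)))\<^sup>2)"
    by (simp add: norm_scaleC nT power_mult_distrib mult.commute)
  also have "\<dots> = (norm (\<Sum>i\<le>n. c i *\<^sub>C T (e i)))\<^sup>2"
    by (rule norm_sum_squared_orthogonal[symmetric])
      (auto simp: adj STe cinner_simps orthonormal_seqD[OF ons] bounded_clinear_scaleC[OF T])
  also have "(\<Sum>i\<le>n. c i *\<^sub>C T (e i)) = T x"
    by (simp add: x_def bounded_clinear_sum[OF T] bounded_clinear_scaleC[OF T])
  finally have "s n * norm x \<le> norm (T x)" by (rule power2_le_imp_le) simp
  then have "s n * norm x \<le> K * norm x" using Tx_le by linarith
  then show ?thesis using \<open>norm x > 0\<close> by simp
qed

lemma singular_system_truncation: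
  assumes T: "bounded_clinear T" and sys: "singular_system T e s"
  shows "norm (T x - (\<Sum>i<n. cinner x (e i) *\<^sub>C T (e i))) \<le> s n * norm x"
proof -
  have ons: "orthonormal_seq e" and nT: "norm (T (e n)) = s n"
    and tail: "\<And>x. \<forall>i<n. cinner x (e i) = 0 \<Longrightarrow> norm (T x) \<le> s n * norm x"
    using sys by (auto simp: singular_system_def)
  define p where "p = (\<Sum>i<n. cinner x (e i) *\<^sub>C e i)"
  have "norm (T (x - p)) \<le> s n * norm (x - p)"
    using projection_remainder(1)[OF ons, of "{..<n}"] by (intro tail) (simp add: p_def)
  also have "\<dots> \<le> s n * norm x"
    unfolding p_def nT[symmetric] by (intro mult_left_mono norm_projection_remainder_le ons) auto
  finally show ?thesis
    by (simp add: p_def bounded_clinear_diff[OF T] bounded_clinear_sum[OF T]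
        bounded_clinear_scaleC[OF T])
qed

lemma compact_bounded_combinations:
  fixes v :: "nat \<Rightarrow> 'a::complex_hilbert"
  shows "\<exists>K. compact K \<and> (\<forall>c. (\<forall>i<n. cmod (c i) \<le> R i) \<longrightarrow> (\<Sum>i<n. c i *\<^sub>C v i) \<in> K)"
proof (induction n)
  case 0
  show ?case by (intro exI[of _ "{0}"]) simp
next
  case (Suc n)
  then obtain K where K: "compact K"
    "\<And>c. (\<forall>i<n. cmod (c i) \<le> R i) \<Longrightarrow> (\<Sum>i<n. c i *\<^sub>C v i) \<in> K" by blast
  have "compact ((\<lambda>c. c *\<^sub>C v n) ` cball 0 (R n))"
    by (intro compact_continuous_image linear_continuous_on scaleC.bounded_linear_left compact_cball)
  then have "compact {x + y | x y. x \<in> K \<and> y \<in> (\<lambda>c. c *\<^sub>C v n) ` cball 0 (R n)}"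
    by (rule compact_sums[OF K(1)])
  moreover have "(\<Sum>i<Suc n. c i *\<^sub>C v i) \<in> {x + y | x y. x \<in> K \<and> y \<in> (\<lambda>c. c *\<^sub>C v n) ` cball 0 (R n)}"
    if "\<forall>i<Suc n. cmod (c i) \<le> R i" for c
  proof -
    have "(\<Sum>i<n. c i *\<^sub>C v i) \<in> K" using that by (intro K(2)) auto
    moreover have "c n *\<^sub>C v n \<in> (\<lambda>c. c *\<^sub>C v n) ` cball 0 (R n)" using that by auto
    ultimately show ?thesis unfolding sum.lessThan_Suc by blast
  qed
  ultimately show ?case by blast
qed

text \<open>
  A finite-rank operator maps the unit ball into a compact set, so that the image under \<open>T\<close> is
  totally bounded.
\<close>

lemma compact_operator_if_finite_rank_limit:
  fixes T :: "'a::complex_hilbert \<Rightarrow> 'a"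
  assumes T: "bounded_clinear T"
    and approx: "\<And>\<delta>. \<delta> > 0 \<Longrightarrow>
      \<exists>(n::nat) u v. \<forall>x. norm (T x - (\<Sum>i<n. cinner x (u i) *\<^sub>C v i)) \<le> \<delta> * norm x"
  shows "compact_operator T"
proof -
  have "\<exists>F. finite F \<and> closure (T ` cball 0 1) \<subseteq> (\<Union>f\<in>F. ball f \<epsilon>)" if eps: "\<epsilon> > 0" for \<epsilon>
  proof -
    obtain n :: nat and u v where uv: "\<And>x. norm (T x - (\<Sum>i<n. cinner x (u i) *\<^sub>C v i)) \<le> \<epsilon>/4 * norm x"
      using approx[OF divide_pos_pos[OF eps zero_less_numeral]] by metis
    obtain K where K: "compact K"
      "\<And>c. (\<forall>i<n. cmod (c i) \<le> norm (u i)) \<Longrightarrow> (\<Sum>i<n. c i *\<^sub>C v i) \<in> K"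
      using compact_bounded_combinations[of n "\<lambda>i. norm (u i)" v] by blast
    obtain F where F: "finite F" "K \<subseteq> (\<Union>f\<in>F. ball f (\<epsilon>/4))"
      using K(1) eps unfolding compact_eq_totally_bounded by (meson divide_pos_pos zero_less_numeral)
    have "T ` cball 0 1 \<subseteq> (\<Union>f\<in>F. cball f (\<epsilon>/2))"
    proof (intro image_subsetI)
      fix x :: 'a assume "x \<in> cball 0 1"
      then have x: "norm x \<le> 1" by simp
      define k where "k = (\<Sum>i<n. cinner x (u i) *\<^sub>C v i)"
      have "cmod (cinner x (u i)) \<le> norm (u i)" for i
        using norm_cinner_le[of x "u i"] mult_right_mono[OF x, of "norm (u i)"] by simp
      then have "k \<in> K" unfolding k_def by (intro K) simp
      then obtain f where f: "f \<in> F" "dist f k < \<epsilon>/4" using F by auto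
      have "dist k (T x) \<le> \<epsilon>/4 * norm x" using uv[of x] by (simp add: k_def dist_norm norm_minus_commute)
      also have "\<dots> \<le> \<epsilon>/4" using x eps by (simp add: mult_left_le)
      finally have "dist f (T x) \<le> \<epsilon>/2" using f(2) dist_triangle[of f "T x" k] by simp
      then show "T x \<in> (\<Union>f\<in>F. cball f (\<epsilon>/2))" using f(1) by auto
    qed
    then have "closure (T ` cball 0 1) \<subseteq> (\<Union>f\<in>F. cball f (\<epsilon>/2))"
      using F(1) by (intro closure_minimal closed_UN) auto
    also have "\<dots> \<subseteq> (\<Union>f\<in>F. ball f \<epsilon>)" using eps by fastforce
    finally show ?thesis using F(1) by blast
  qed
  then show ?thesis
    using T by (simp add: compact_operator_def compact_eq_totally_bounded complete_eq_closed)
qed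

text \<open>
  The growth of the approximation numbers is at most that of \<open>g\<close>.  Operators of rank at most \<open>n\<close>
  are given by \<open>n\<close> pairs of vectors, the form in which their traces are computed below.
\<close>

definition approximable :: "(real \<Rightarrow> real) \<Rightarrow> ('a::complex_hilbert \<Rightarrow> 'a) \<Rightarrow> bool" where
  "approximable g T \<longleftrightarrow> (\<exists>C. \<forall>n::nat. \<exists>u v. \<forall>x.
     norm (T x - (\<Sum>i<n. cinner x (u i) *\<^sub>C v i)) \<le> C * g (real n) * norm x)"

lemma bigo_sequence_iff:
  fixes s h :: "nat \<Rightarrow> real"
  assumes "\<And>n. s n \<ge> 0" "\<And>n. h n > 0"
  shows "s \<in> O(h) \<longleftrightarrow> (\<exists>C. \<forall>n. s n \<le> C * h n)"
proof
  assume "s \<in> O(h)"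
  then obtain c where "\<forall>\<^sub>F n in sequentially. norm (s n) \<le> c * norm (h n)"
    by (auto elim: landau_o.bigE)
  then obtain N where N: "\<And>n. n \<ge> N \<Longrightarrow> s n \<le> c * h n"
    using assms(1) less_imp_le[OF assms(2)] by (auto simp: eventually_sequentially)
  define C where "C = \<bar>c\<bar> + (\<Sum>i<N. s i / h i)"
  have pos: "0 \<le> s i / h i" for i using assms[of i] less_imp_le[OF assms(2)[of i]] by simp
  have "s n \<le> C * h n" for n
  proof (cases "n < N")
    case True
    have "s n / h n \<le> (\<Sum>i<N. s i / h i)"
      using True pos by (intro member_le_sum) auto
    then have "s n / h n \<le> C" by (simp add: C_def)
    then show ?thesis using assms(2)[of n] by (simp add: divide_le_eq)
  next
    case False
    have "c \<le> C" using sum_nonneg[of "{..<N}" "\<lambda>i. s i / h i"] pos by (simp add: C_def)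
    then have "c * h n \<le> C * h n" using assms(2)[of n] by simp
    then show ?thesis using N[of n] False by simp
  qed
  then show "\<exists>C. \<forall>n. s n \<le> C * h n" by blast
next
  assume "\<exists>C. \<forall>n. s n \<le> C * h n"
  then obtain C where C: "\<And>n. s n \<le> C * h n" by blast
  show "s \<in> O(h)"
  proof (rule landau_o.bigI)
    have "s n \<le> max C 1 * h n" for n
      by (rule order_trans[OF C mult_right_mono]) (use less_imp_le[OF assms(2)] in auto)
    then show "\<forall>\<^sub>F n in sequentially. norm (s n) \<le> max C 1 * norm (h n)"
      using assms(1) less_imp_le[OF assms(2)] by (intro always_eventually) simp
  qed simp
qed

text \<open>
  Truncating the singular value decomposition gives one direction, the min-max principle the
  other.  This description of the ideal is the one with which commutators are accessible.
\<close>

lemma weak_lorentz_iff_approximable: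
  fixes T :: "'a::complex_hilbert \<Rightarrow> 'a"
  assumes dim: "\<not> (\<exists>B :: 'a set. finite B \<and> cspan B = UNIV)"
    and \<xi>: "orthonormal_basis (\<xi> :: nat \<Rightarrow> 'a)"
    and g: "\<And>t. t \<ge> 0 \<Longrightarrow> g t > 0" "(\<lambda>n. g (real n)) \<longlonglongrightarrow> 0"
  shows "T \<in> weak_lorentz g \<longleftrightarrow> bounded_clinear T \<and> approximable g T"
proof -
  have main: "(\<lambda>j. singular_value T j) \<in> O(\<lambda>j. g (real j)) \<longleftrightarrow> approximable g T"
    if T: "compact_operator T"
  proof -
    have Tb: "bounded_clinear T" using T by (simp add: compact_operator_def)
    obtain S where S: "bounded_clinear S" and adj: "\<And>x y. cinner (T x) y = cinner x (S y)"
      using adjoint_exists[OF \<xi> Tb] by blast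
    obtain e s where sys: "singular_system T e s"
      using singular_system_exists[OF dim T S adj] by blast
    have sv: "singular_value T = s" by (rule singular_value_eq[OF Tb S adj sys])
    have adj': "cinner (T x) y = cinner x (cadjoint T y)" for x y
      using adj cadjoint_eq[of T S, OF adj] by simp
    have s_nonneg: "s n \<ge> 0" for n using sys by (simp add: singular_system_def)
    have "(\<exists>C. \<forall>n. s n \<le> C * g (real n)) \<longleftrightarrow> approximable g T"
    proof
      assume "\<exists>C. \<forall>n. s n \<le> C * g (real n)"
      then obtain C where C: "\<And>n. s n \<le> C * g (real n)" by blast
      have "norm (T x - (\<Sum>i<n. cinner x (e i) *\<^sub>C T (e i))) \<le> C * g (real n) * norm x" for n x
        using singular_system_truncation[OF Tb sys, of x n]
          mult_right_mono[OF C[of n], of "norm x"] by simp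
      then show "approximable g T"
        unfolding approximable_def
        by (intro exI[of _ C] allI exI[of _ e] exI[of _ "\<lambda>i. T (e i)"])
    next
      assume "approximable g T"
      then show "\<exists>C. \<forall>n. s n \<le> C * g (real n)"
        unfolding approximable_def
        using singular_system_le_approximation_error[OF Tb adj' sys] by metis
    qed
    then show ?thesis
      unfolding sv using bigo_sequence_iff[of s "\<lambda>j. g (real j)"] s_nonneg g(1) by simp
  qed
  have compact: "compact_operator T" if T: "bounded_clinear T" and app: "approximable g T"
  proof (rule compact_operator_if_finite_rank_limit[OF T])
    fix \<delta> :: real assume "\<delta> > 0"
    obtain C where C: "\<And>n::nat. \<exists>u v. \<forall>x.
        norm (T x - (\<Sum>i<n. cinner x (u i) *\<^sub>C v i)) \<le> C * g (real n) * norm x"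
      using app unfolding approximable_def by blast
    have "(\<lambda>n. C * g (real n)) \<longlonglongrightarrow> C * 0" by (intro tendsto_intros g)
    then obtain n where n: "C * g (real n) < \<delta>"
      using order_tendstoD(2)[of _ "C * 0" sequentially \<delta>] \<open>\<delta> > 0\<close>
      by (auto simp: eventually_sequentially)
    obtain u v where uv: "\<And>x. norm (T x - (\<Sum>i<n. cinner x (u i) *\<^sub>C v i)) \<le> C * g (real n) * norm x"
      using C[of n] by blast
    have "norm (T x - (\<Sum>i<n. cinner x (u i) *\<^sub>C v i)) \<le> \<delta> * norm x" for x
      using uv[of x] mult_right_mono[OF less_imp_le[OF n], of "norm x"] by simp
    then show "\<exists>(n::nat) u v. \<forall>x. norm (T x - (\<Sum>i<n. cinner x (u i) *\<^sub>C v i)) \<le> \<delta> * norm x"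
      by blast
  qed
  show ?thesis
  proof
    assume "T \<in> weak_lorentz g"
    then have "compact_operator T" "(\<lambda>j. singular_value T j) \<in> O(\<lambda>j. g (real j))"
      by (simp_all add: weak_lorentz_def)
    then show "bounded_clinear T \<and> approximable g T"
      using main by (simp add: compact_operator_def)
  next
    assume "bounded_clinear T \<and> approximable g T"
    then show "T \<in> weak_lorentz g"
      using main[OF compact] compact by (simp add: weak_lorentz_def)
  qed
qed

definition dominated :: "(real \<Rightarrow> real) \<Rightarrow> (nat \<Rightarrow> complex) \<Rightarrow> bool" where
  "dominated g w \<longleftrightarrow> (\<exists>C\<ge>0. \<forall>j. cmod (w j) \<le> C * g (real j))"

lemma dominatedI:
  assumes "\<And>j. g (real j) > 0" "\<And>j. cmod (w j) \<le> C * g (real j)"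
  shows "dominated g w"
proof -
  have "0 \<le> C * g (real 0)" using assms(2)[of 0] norm_ge_zero order_trans by metis
  then have "C \<ge> 0" using assms(1)[of 0] by (simp add: zero_le_mult_iff)
  then show ?thesis using assms(2) by (auto simp: dominated_def)
qed

lemma dominated_lincomb:
  assumes "dominated g v" "dominated g w"
  shows "dominated g (\<lambda>j. a * v j + b * w j)"
proof -
  obtain C D where C: "C \<ge> 0" "\<And>j. cmod (v j) \<le> C * g (real j)"
    and D: "D \<ge> 0" "\<And>j. cmod (w j) \<le> D * g (real j)"
    using assms by (auto simp: dominated_def)
  have "cmod (a * v j + b * w j) \<le> (cmod a * C + cmod b * D) * g (real j)" for j
  proof -
    have "cmod (a * v j + b * w j) \<le> cmod a * cmod (v j) + cmod b * cmod (w j)"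
      by (metis norm_mult norm_triangle_ineq)
    also have "\<dots> \<le> cmod a * (C * g (real j)) + cmod b * (D * g (real j))"
      by (intro add_mono mult_left_mono C D) auto
    finally show ?thesis by (simp add: algebra_simps)
  qed
  then show ?thesis
    unfolding dominated_def using C(1) D(1) by (intro exI[of _ "cmod a * C + cmod b * D"]) auto
qed

lemma dominated_bounded:
  assumes "dominated g w" "\<And>i j. i \<le> j \<Longrightarrow> g (real j) \<le> M * g (real i)"
  shows "bounded (range w)"
proof -
  obtain C where C: "C \<ge> 0" "\<And>j. cmod (w j) \<le> C * g (real j)"
    using assms(1) by (auto simp: dominated_def)
  have "cmod (w j) \<le> C * (M * g 0)" for j
    using C(2)[of j] mult_left_mono[OF assms(2)[of 0 j] C(1)] by simp
  then show ?thesis by (auto simp: bounded_iff)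
qed

lemma schmidt_op_approximable:
  assumes e: "orthonormal_seq e" and f: "orthonormal_seq f" and w: "dominated g w"
    and M: "\<And>i j. i \<le> j \<Longrightarrow> g (real j) \<le> M * g (real i)"
  shows "approximable g (schmidt_op w e f)"
proof -
  obtain C where C: "C \<ge> 0" "\<And>j. cmod (w j) \<le> C * g (real j)"
    using w by (auto simp: dominated_def)
  have w': "cmod (w j) \<le> C * M * g (real n)" if "j \<ge> n" for j n
    using C(2)[of j] mult_left_mono[OF M[OF that] C(1)] by (simp add: mult.assoc)
  note bdd = dominated_bounded[OF w M]
  show "approximable g (schmidt_op w e f)"
    unfolding approximable_def
  proof (intro exI allI)
    fix n x
    define p where "p = (\<Sum>i<n. cinner x (e i) *\<^sub>C e i)"
    note P = schmidt_op_bounded_clinear[OF e f bdd]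
    have "schmidt_op w e f p = (\<Sum>i<n. cinner x (e i) *\<^sub>C w i *\<^sub>C f i)"
      by (simp add: p_def bounded_clinear_sum[OF P] bounded_clinear_scaleC[OF P]
          schmidt_op_basis[OF e f])
    then have "norm (schmidt_op w e f x - (\<Sum>i<n. cinner x (e i) *\<^sub>C w i *\<^sub>C f i))
        = norm (schmidt_op w e f (x - p))"
      by (simp add: bounded_clinear_diff[OF P])
    also have "\<dots> \<le> (C * M * g (real n)) * norm (x - p)"
    proof (rule schmidt_op_norm_le[OF e f])
      show "0 \<le> C * M * g (real n)" by (rule order_trans[OF norm_ge_zero w'[OF order_refl]])
      show "cmod (w j) \<le> C * M * g (real n)" if "cinner (x - p) (e j) \<noteq> 0" for j
        using that projection_remainder(1)[OF e, of "{..<n}" j x]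
        by (intro w') (auto simp: p_def not_less[symmetric])
    qed
    also have "\<dots> \<le> (C * M * g (real n)) * norm x"
      unfolding p_def
      by (intro mult_left_mono norm_projection_remainder_le e order_trans[OF norm_ge_zero w'[OF order_refl]])
        simp
    finally show "norm (schmidt_op w e f x - (\<Sum>i<n. cinner x (e i) *\<^sub>C w i *\<^sub>C f i))
        \<le> (C * M) * g (real n) * norm x" .
  qed
qed


section \<open>Regularly varying functions of index \<open>-1\<close>\<close>

lemma RV_minus_one_doubling:
  assumes "RV_minus_one g"
  shows "((\<lambda>t. g (2 * t) / g t) \<longlongrightarrow> inverse 2) at_top"
proof -
  have "\<forall>c>0. ((\<lambda>t. g (c * t) / g t) \<longlongrightarrow> inverse c) at_top"
    using assms unfolding RV_minus_one_def by blast
  from this[rule_format, of 2] show ?thesis by simp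
qed

text \<open>An ultimately increasing \<open>g\<close> would have \<open>g(2t)/g(t) \<ge> 1\<close>, against the limit \<open>1/2\<close>.\<close>

lemma RV_minus_one_eventually_antimono:
  assumes "RV_minus_one g"
  obtains a where "a \<ge> 0" "antimono_on {a..} g"
proof -
  obtain a where a: "a \<ge> 0" "mono_on {a..} g \<or> antimono_on {a..} g"
    using assms by (auto simp: RV_minus_one_def)
  have "\<not> mono_on {a..} g"
  proof
    assume mono: "mono_on {a..} g"
    have "\<forall>\<^sub>F t in at_top. 1 \<le> g (2 * t) / g t"
      using eventually_ge_at_top[of a]
    proof eventually_elim
      case (elim t)
      then have "g t \<le> g (2 * t)" using a(1) by (intro mono_onD[OF mono]) auto
      moreover have "g t > 0" using assms elim a(1) by (simp add: RV_minus_one_def)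
      ultimately show ?case by simp
    qed
    then have "1 \<le> inverse (2::real)" by (rule tendsto_lowerbound[OF RV_minus_one_doubling[OF assms]]) simp
    then show False by simp
  qed
  then show ?thesis using a that by blast
qed

text \<open>A positive limit of \<open>g\<close> would make \<open>g(2t)/g(t)\<close> tend to \<open>1\<close>.\<close>

lemma RV_minus_one_tendsto_0:
  assumes "RV_minus_one g"
  shows "(g \<longlongrightarrow> 0) at_top"
proof -
  obtain a where a: "a \<ge> 0" "antimono_on {a..} g" by (rule RV_minus_one_eventually_antimono[OF assms])
  have pos: "g t > 0" if "t \<ge> 0" for t using assms that by (simp add: RV_minus_one_def)
  define L where "L = Inf (g ` {a..})"
  have bdd: "bdd_below (g ` {a..})"
    using pos a(1) by (intro bdd_belowI[where m = 0]) (auto intro: less_imp_le)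
  have L_le: "L \<le> g t" if "t \<ge> a" for t
    unfolding L_def using that by (intro cInf_lower bdd) auto
  have lim: "(g \<longlongrightarrow> L) at_top"
  proof (rule order_tendstoI)
    fix y assume "y < L"
    then show "\<forall>\<^sub>F t in at_top. y < g t"
      using L_le by (intro eventually_at_top_linorderI[of a]) force
  next
    fix y assume "L < y"
    then obtain t0 where t0: "t0 \<ge> a" "g t0 < y"
      using cInf_lessD[of "g ` {a..}" y] by (auto simp: L_def)
    have "g t < y" if "t \<ge> t0" for t
      using monotone_onD[OF a(2), of t0 t] that t0 by auto
    then show "\<forall>\<^sub>F t in at_top. g t < y" by (rule eventually_at_top_linorderI)
  qed
  have "L = 0"
  proof (rule ccontr)
    assume "L \<noteq> 0"
    have "filterlim (\<lambda>t::real. 2 * t) at_top at_top"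
      by (rule filterlim_tendsto_pos_mult_at_top[OF tendsto_const]) (auto simp: filterlim_ident)
    then have "((\<lambda>t. g (2 * t) / g t) \<longlongrightarrow> L / L) at_top"
      using \<open>L \<noteq> 0\<close> by (intro tendsto_divide lim filterlim_compose[OF lim])
    from tendsto_unique[OF _ this RV_minus_one_doubling[OF assms]]
    have "L / L = inverse 2" by simp
    then show False using \<open>L \<noteq> 0\<close> by simp
  qed
  then show ?thesis using lim by simp
qed

text \<open>
  Being decreasing only from some point on, \<open>g\<close> still decreases up to a constant factor on the
  whole half-line; this takes the place of monotonicity in all later comparisons.
\<close>

lemma RV_minus_one_quasi_antimono:
  assumes "RV_minus_one g"
  obtains M where "M > 0" "\<And>s t. 0 \<le> s \<Longrightarrow> s \<le> t \<Longrightarrow> g t \<le> M * g s"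
proof -
  obtain a where a: "a \<ge> 0" "antimono_on {a..} g" by (rule RV_minus_one_eventually_antimono[OF assms])
  have pos: "g t > 0" if "t \<ge> 0" for t using assms that by (simp add: RV_minus_one_def)
  have cont: "continuous_on {0..a} g"
    using assms by (auto simp: RV_minus_one_def intro: continuous_on_subset)
  have ne: "{0..a} \<noteq> {}" using a(1) by simp
  obtain t1 where t1: "t1 \<in> {0..a}" "\<And>t. t \<in> {0..a} \<Longrightarrow> g t1 \<le> g t"
    using continuous_attains_inf[OF compact_Icc ne cont] by blast
  obtain t2 where t2: "t2 \<in> {0..a}" "\<And>t. t \<in> {0..a} \<Longrightarrow> g t \<le> g t2"
    using continuous_attains_sup[OF compact_Icc ne cont] by blast
  define M where "M = g t2 / g t1"
  have g1: "g t1 > 0" using t1(1) by (intro pos) simp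
  then have M1: "M \<ge> 1" using t2(2)[OF t1(1)] by (simp add: M_def)
  have "g t \<le> M * g s" if st: "0 \<le> s" "s \<le> t" for s t
  proof (cases "s \<ge> a")
    case True
    then have "g t \<le> 1 * g s" using monotone_onD[OF a(2), of s t] st by auto
    also have "\<dots> \<le> M * g s" using M1 pos[OF st(1)] by (intro mult_right_mono) auto
    finally show ?thesis .
  next
    case False
    have "g t \<le> g t2"
    proof (cases "t \<le> a")
      case True
      then show ?thesis using st by (intro t2) auto
    next
      case False
      then have "g t \<le> g a" using monotone_onD[OF a(2), of a t] by auto
      then show ?thesis using t2(2)[of a] a(1) by simp
    qed
    also have "\<dots> = M * g t1" using g1 by (simp add: M_def)
    also have "\<dots> \<le> M * g s" using t1(2)[of s] False st M1 by (intro mult_left_mono) auto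
    finally show ?thesis .
  qed
  then show ?thesis using that[of M] M1 by simp
qed

lemma
  fixes h :: "real \<Rightarrow> real"
  assumes cont: "continuous_on {0..} h"
    and M: "M > 0" "\<And>s t. 0 \<le> s \<Longrightarrow> s \<le> t \<Longrightarrow> h t \<le> M * h s"
  shows integral_le_sum: "integral {0..real n} h \<le> M * (\<Sum>j<n. h (real j))"
    and sum_le_integral: "(\<Sum>j\<le>n. h (real j)) \<le> h 0 + M * integral {0..real n} h"
proof -
  have int: "h integrable_on {a..b}" if "a \<ge> 0" for a b
    using that by (intro integrable_continuous_real continuous_on_subset[OF cont]) auto
  have split: "integral {0..real (Suc n)} h = integral {0..real n} h + integral {real n..real (Suc n)} h"
    for n
    by (rule Henstock_Kurzweil_Integration.integral_combine[symmetric]) (auto intro: int)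
  have up: "integral {real n..real (Suc n)} h \<le> M * h (real n)" for n
  proof -
    have "integral {real n..real (Suc n)} h \<le> integral {real n..real (Suc n)} (\<lambda>_. M * h (real n))"
      by (intro integral_le int M integrable_const_ivl) auto
    then show ?thesis by simp
  qed
  have lo: "h (real (Suc n)) \<le> M * integral {real n..real (Suc n)} h" for n
  proof -
    have "integral {real n..real (Suc n)} (\<lambda>_. h (real (Suc n)))
        \<le> integral {real n..real (Suc n)} (\<lambda>t. M * h t)"
      by (intro integral_le integrable_on_mult_right int M integrable_const_ivl) auto
    then show ?thesis by simp
  qed
  show "integral {0..real n} h \<le> M * (\<Sum>j<n. h (real j))"
  proof (induction n)
    case (Suc n)
    then show ?case using split[of n] up[of n] by (simp add: distrib_left)
  qed simp
  show "(\<Sum>j\<le>n. h (real j)) \<le> h 0 + M * integral {0..real n} h"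
  proof (induction n)
    case (Suc n)
    then show ?case using split[of n] lo[of n] by (simp add: distrib_left)
  qed simp
qed


section \<open>Traces of diagonal operators\<close>

definition commutators :: "('a::complex_hilbert \<Rightarrow> 'a) set \<Rightarrow> ('a \<Rightarrow> 'a) set" where
  "commutators I = {\<lambda>x. A (T x) - T (A x) | A T. bounded_clinear A \<and> T \<in> I}"

text \<open>
  With \<open>T = schmidt_op w e f\<close> and the partial isometry \<open>A\<close> that maps \<open>f\<^sub>j\<close> to \<open>e\<^sub>j\<close>, the
  products \<open>A T\<close> and \<open>T A\<close> are the diagonal operators in the two systems.  This covers the
  unitary invariance of traces as well as their invariance under spreading out a diagonal.
\<close>

lemma diagonal_difference_commutator:
  assumes e: "orthonormal_seq e" and f: "orthonormal_seq f" and w: "bounded (range w)"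
    and I: "schmidt_op w e f \<in> I"
  shows "(\<lambda>x. schmidt_op w e e x - schmidt_op w f f x) \<in> commutators I"
proof -
  define A where "A = schmidt_op (\<lambda>_. 1) f e"
  have "bounded_clinear A" unfolding A_def by (rule schmidt_op_bounded_clinear[OF f e]) simp
  then have "(\<lambda>x. A (schmidt_op w e f x) - schmidt_op w e f (A x)) \<in> commutators I"
    unfolding commutators_def using I by blast
  then show ?thesis
    unfolding A_def by (simp add: schmidt_op_comp[OF e f w] schmidt_op_comp[OF f e])
qed

lemma trace_on_commutators: "trace_on I \<phi> \<Longrightarrow> X \<in> commutators I \<Longrightarrow> \<phi> X = 0"
  by (auto simp: trace_on_def commutators_def)

text \<open>
  The binary tree on the natural numbers has root \<open>0\<close>, and \<open>j\<close> has the children \<open>2j+1\<close> and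
  \<open>2j+2\<close>.  The sequence \<open>b = dyadic_average a\<close> solves \<open>a\<^sub>j = b\<^sub>j - b\<^sub>p / 2\<close> with \<open>p\<close> the
  parent of \<open>j\<close>, that is \<open>b\<^sub>j = a\<^sub>j + a\<^sub>p / 2 + a\<^bsub>p'\<^esub> / 4 + \<dots>\<close> along the path from \<open>j\<close> to
  the root.
\<close>

fun dyadic_average :: "(nat \<Rightarrow> real) \<Rightarrow> nat \<Rightarrow> real" where
  "dyadic_average a j = a j + (if j = 0 then 0 else dyadic_average a ((j - 1) div 2) / 2)"

declare dyadic_average.simps [simp del]

lemma dyadic_average_nonneg: "(\<And>j. a j \<ge> 0) \<Longrightarrow> dyadic_average a j \<ge> 0"
  by (induction a j rule: dyadic_average.induct) (subst dyadic_average.simps, auto)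

text \<open>
  The weights \<open>j + 2\<close> make the recursion telescope: \<open>j + 2 \<le> 2 (p + 2)\<close> for the parent \<open>p\<close>, so
  that \<open>(j + 2) b\<^sub>j\<close> exceeds \<open>(p + 2) b\<^sub>p\<close> by at most \<open>(j + 2) a\<^sub>j\<close>, and the nodes after \<open>p\<close> up
  to \<open>j\<close> are numerous enough to pay for that.
\<close>

lemma dyadic_average_le_mean:
  assumes a: "\<And>j. a j \<ge> 0" and M: "M > 0" "\<And>i j. i \<le> j \<Longrightarrow> a j \<le> M * a i"
  shows "real (j + 2) * dyadic_average a j \<le> 3 * M * (\<Sum>i\<le>j. a i)"
proof (induction j rule: less_induct)
  case (less j)
  show ?case
  proof (cases "j = 0")
    case True
    have "2 * a 0 \<le> 3 * (M * a 0)" using M(2)[of 0 0] a[of 0] by linarith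
    then show ?thesis using True by (simp add: dyadic_average.simps)
  next
    case False
    define p where "p = (j - 1) div 2"
    have p: "p < j" "j = 2 * p + 1 \<or> j = 2 * p + 2" using False by (auto simp: p_def)
    (* The nodes p+1, ..., j are at least (j+2)/3 in number. *)
    have "real (j + 2) * a j \<le> 3 * (real (j - p) * a j)"
      using p(2) a[of j] by (auto simp: algebra_simps)
    also have "real (j - p) * a j = (\<Sum>i\<in>{p<..j}. a j)" by simp
    also have "\<dots> \<le> (\<Sum>i\<in>{p<..j}. M * a i)" by (intro sum_mono M) auto
    finally have new: "real (j + 2) * a j \<le> 3 * M * (\<Sum>i\<in>{p<..j}. a i)"
      by (simp add: sum_distrib_left mult.assoc)
    have "real (j + 2) * (dyadic_average a p / 2) \<le> real (p + 2) * dyadic_average a p"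
      using p(2) dyadic_average_nonneg[of a p, OF a] by (auto simp: algebra_simps)
    also have "\<dots> \<le> 3 * M * (\<Sum>i\<le>p. a i)" by (rule less.IH[OF p(1)])
    finally have old: "real (j + 2) * (dyadic_average a p / 2) \<le> 3 * M * (\<Sum>i\<le>p. a i)" .
    have "{..j} = {..p} \<union> {p<..j}" using p(1) by auto
    then have "(\<Sum>i\<le>j. a i) = (\<Sum>i\<le>p. a i) + (\<Sum>i\<in>{p<..j}. a i)"
      by (simp only:) (rule sum.union_disjoint, auto)
    moreover have "dyadic_average a j = a j + dyadic_average a p / 2"
      using False by (subst dyadic_average.simps) (simp add: p_def)
    ultimately show ?thesis using new old by (simp add: distrib_left)
  qed
qed

context
  fixes g :: "real \<Rightarrow> real" and I :: "('a::complex_hilbert \<Rightarrow> 'a) set"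
    and \<phi> :: "('a \<Rightarrow> 'a) \<Rightarrow> complex"
  assumes in_I: "\<And>w e f. orthonormal_seq e \<Longrightarrow> orthonormal_seq f \<Longrightarrow> dominated g w \<Longrightarrow> schmidt_op w e f \<in> I"
    and bdd: "\<And>w. dominated g w \<Longrightarrow> bounded (range w)"
    and tr: "trace_on I \<phi>"
begin

lemma trace_schmidt_op_lincomb:
  assumes e: "orthonormal_seq e" and f: "orthonormal_seq f" and "dominated g v" "dominated g w"
  shows "\<phi> (schmidt_op (\<lambda>j. a * v j + b * w j) e f)
    = a * \<phi> (schmidt_op v e f) + b * \<phi> (schmidt_op w e f)"
proof -
  have scale: "(\<lambda>x. c *\<^sub>C schmidt_op u e f x) \<in> I" if "dominated g u" for c u
  proof -
    have "schmidt_op (\<lambda>j. c * u j + 0 * u j) e f \<in> I"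
      by (intro in_I e f dominated_lincomb that)
    also have "schmidt_op (\<lambda>j. c * u j + 0 * u j) e f = (\<lambda>x. c *\<^sub>C schmidt_op u e f x)"
      by (rule ext) (subst schmidt_op_lincomb[OF e f], simp_all add: bdd that)
    finally show ?thesis .
  qed
  have "schmidt_op (\<lambda>j. a * v j + b * w j) e f
      = (\<lambda>x. a *\<^sub>C schmidt_op v e f x + b *\<^sub>C schmidt_op w e f x)"
    by (rule ext) (rule schmidt_op_lincomb[OF e f bdd bdd]; fact)
  then show ?thesis
    using tr scale[OF assms(3), of a] scale[OF assms(4), of b] in_I[OF e f assms(3)] in_I[OF e f assms(4)]
    by (simp add: trace_on_def)
qed

lemma trace_diagonal_independent:
  assumes e: "orthonormal_seq e" and f: "orthonormal_seq f" and w: "dominated g w"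
  shows "\<phi> (schmidt_op w e e) = \<phi> (schmidt_op w f f)"
proof -
  have diff: "\<phi> (\<lambda>x. schmidt_op w e e x - schmidt_op w f f x) = 0"
    using tr diagonal_difference_commutator[OF e f bdd[OF w] in_I[OF e f w]]
    by (rule trace_on_commutators)
  define w' where "w' j = (- 1) * w j + 0 * w j" for j
  have "schmidt_op w' f f x = - schmidt_op w f f x" for x
    unfolding w'_def
    by (subst schmidt_op_lincomb[OF f f bdd[OF w] bdd[OF w]]) (simp add: scaleC.minus_left)
  then have diff': "\<phi> (\<lambda>x. schmidt_op w e e x + schmidt_op w' f f x) = 0"
    using diff by simp
  have "schmidt_op w' f f \<in> I"
    unfolding w'_def by (intro in_I f dominated_lincomb w)
  then have "\<phi> (schmidt_op w e e) + \<phi> (schmidt_op w' f f) = 0"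
    using tr in_I[OF e e w] diff' unfolding trace_on_def by metis
  then show ?thesis
    using trace_schmidt_op_lincomb[OF f f w w, of "-1" 0] unfolding w'_def by simp
qed

text \<open>
  Moving every entry of a diagonal to the two children of its index gives the sum of two operators
  that are diagonal with entries \<open>b\<close> in the subsequences of odd and of positive even index.
\<close>

lemma trace_two_copies:
  assumes \<xi>: "orthonormal_basis \<xi>" and b: "dominated g b"
    and c: "dominated g (\<lambda>j. if j = 0 then 0 else b ((j - 1) div 2))"
  shows "\<phi> (schmidt_op (\<lambda>j. if j = 0 then 0 else b ((j - 1) div 2)) \<xi> \<xi>) = 2 * \<phi> (schmidt_op b \<xi> \<xi>)"
proof -
  have ons: "orthonormal_seq \<xi>" using \<xi> by (rule orthonormal_basis_seq)
  define odds where "odds j = \<xi> (2 * j + 1)" for j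
  define evens where "evens j = \<xi> (2 * j + 2)" for j
  have o: "orthonormal_seq odds" and e: "orthonormal_seq evens"
    unfolding odds_def evens_def by (intro orthonormal_seq_comp[OF ons] injI; simp)+
  define c where "c = (\<lambda>j::nat. if j = 0 then 0 else b ((j - 1) div 2))"
  have "schmidt_op c \<xi> \<xi> = (\<lambda>x. schmidt_op b odds odds x + schmidt_op b evens evens x)"
  proof (rule bounded_clinear_eq_on_dense[where X = "range \<xi>"])
    show "bounded_clinear (schmidt_op c \<xi> \<xi>)"
      using assms(3) unfolding c_def by (intro schmidt_op_bounded_clinear ons bdd)
    show "bounded_clinear (\<lambda>x. schmidt_op b odds odds x + schmidt_op b evens evens x)"
      by (intro bounded_clinear_add_fun schmidt_op_bounded_clinear o e bdd b)
    show "closure (cspan (range \<xi>)) = UNIV" using \<xi> by (simp add: orthonormal_basis_def)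
    fix x assume "x \<in> range \<xi>"
    then obtain k where k: "x = \<xi> k" by blast
    have odds0: "schmidt_op b odds odds (\<xi> k) = 0" if "\<And>j. k \<noteq> 2 * j + 1"
      by (rule schmidt_op_orthogonal[OF o o]) (use that in \<open>simp add: odds_def orthonormal_seqD[OF ons]\<close>)
    have evens0: "schmidt_op b evens evens (\<xi> k) = 0" if "\<And>j. k \<noteq> 2 * j + 2"
      by (rule schmidt_op_orthogonal[OF e e]) (use that in \<open>simp add: evens_def orthonormal_seqD[OF ons]\<close>)
    consider "k = 0" | j where "k = 2 * j + 1" | j where "k = 2 * j + 2"
    proof (cases k)
      case (Suc m)
      then show thesis using that(2)[of "m div 2"] that(3)[of "m div 2"] by (cases "even m") auto
    qed (use that in blast)
    then show "schmidt_op c \<xi> \<xi> x = schmidt_op b odds odds x + schmidt_op b evens evens x"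
    proof cases
      case 1
      then show ?thesis
        using odds0 evens0 unfolding k by (simp add: schmidt_op_basis[OF ons ons] c_def)
    next
      case (2 j)
      have "2 * j + 1 \<noteq> 2 * i + 2" for i :: nat by presburger
      then have "schmidt_op b evens evens (\<xi> k) = 0" using 2 by (intro evens0) simp
      then show ?thesis
        using schmidt_op_basis[OF o o, of b j] unfolding k
        by (simp add: schmidt_op_basis[OF ons ons] c_def odds_def 2)
    next
      case (3 j)
      have "2 * j + 2 \<noteq> 2 * i + 1" for i :: nat by presburger
      then have "schmidt_op b odds odds (\<xi> k) = 0" using 3 by (intro odds0) simp
      then show ?thesis
        using schmidt_op_basis[OF e e, of b j] unfolding k
        by (simp add: schmidt_op_basis[OF ons ons] c_def evens_def 3)
    qed
  qed
  then have "\<phi> (schmidt_op c \<xi> \<xi>) = \<phi> (schmidt_op b odds odds) + \<phi> (schmidt_op b evens evens)"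
    using tr in_I[OF o o b] in_I[OF e e b] by (simp add: trace_on_def)
  also have "\<dots> = 2 * \<phi> (schmidt_op b \<xi> \<xi>)"
    using trace_diagonal_independent[OF ons o b] trace_diagonal_independent[OF ons e b] by simp
  finally show ?thesis by (simp add: c_def)
qed

text \<open>
  The sufficient half of the criterion that a diagonal operator with positive decreasing entries
  lies in the commutator space of the ideal if and only if the arithmetic means of its entries obey
  the growth bound of the ideal.  One commutator per child in the binary tree is enough.
\<close>

lemma trace_vanishes_if_means_dominated:
  assumes \<xi>: "orthonormal_basis \<xi>" and g: "\<And>j. g (real j) > 0"
    and a: "\<And>j. a j \<ge> 0" and M: "M > 0" "\<And>i j. i \<le> j \<Longrightarrow> a j \<le> M * a i"
    and means: "\<And>j. (\<Sum>i\<le>j. a i) \<le> K * real (j + 1) * g (real j)"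
  shows "\<phi> (schmidt_op (\<lambda>j. of_real (a j)) \<xi> \<xi>) = 0"
proof -
  have ons: "orthonormal_seq \<xi>" using \<xi> by (rule orthonormal_basis_seq)
  define b where "b = dyadic_average a"
  define c where "c = (\<lambda>j::nat. if j = 0 then 0 else complex_of_real (b ((j - 1) div 2)))"
  have b_rec: "b j = a j + (if j = 0 then 0 else b ((j - 1) div 2) / 2)" for j
    unfolding b_def by (subst dyadic_average.simps) simp
  have b_nonneg: "b j \<ge> 0" for j unfolding b_def by (rule dyadic_average_nonneg[OF a])
  have b_le: "b j \<le> 3 * M * K * g (real j)" for j
  proof -
    have "0 \<le> K * (real (j + 1) * g (real j))"
      using means[of j] sum_nonneg[of "{..j}" a] a by (simp add: mult.assoc)
    moreover have "0 < real (j + 1) * g (real j)" using g[of j] by simp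
    ultimately have "K \<ge> 0" by (simp add: zero_le_mult_iff)
    have "real (j + 2) * b j \<le> 3 * M * (\<Sum>i\<le>j. a i)"
      unfolding b_def by (rule dyadic_average_le_mean[OF a M])
    also have "\<dots> \<le> 3 * M * (K * real (j + 1) * g (real j))"
      using means[of j] M(1) by (intro mult_left_mono) auto
    also have "\<dots> \<le> 3 * M * (K * real (j + 2) * g (real j))"
      using M(1) \<open>K \<ge> 0\<close> less_imp_le[OF g[of j]] by (intro mult_left_mono mult_right_mono) auto
    also have "\<dots> = real (j + 2) * (3 * M * K * g (real j))" by (simp only: mult_ac)
    finally show ?thesis by (rule mult_left_le_imp_le) simp
  qed
  have db: "dominated g (\<lambda>j. of_real (b j))"
    by (rule dominatedI[of _ _ "3 * M * K"]) (use g b_le b_nonneg in auto)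
  have dc: "dominated g c"
  proof (rule dominatedI[of _ _ "2 * (3 * M * K)"])
    fix j
    have "cmod (c j) \<le> 2 * b j"
      using b_rec[of j] b_nonneg a[of j] by (auto simp: c_def)
    also have "\<dots> \<le> 2 * (3 * M * K) * g (real j)" using b_le[of j] by (simp add: mult_ac)
    finally show "cmod (c j) \<le> 2 * (3 * M * K) * g (real j)" .
  qed (rule g)
  have "(\<lambda>j. complex_of_real (a j)) = (\<lambda>j. 1 * of_real (b j) + (- 1 / 2) * c j)"
    by (rule ext) (use b_rec in \<open>auto simp: c_def\<close>)
  then have "\<phi> (schmidt_op (\<lambda>j. of_real (a j)) \<xi> \<xi>)
      = \<phi> (schmidt_op (\<lambda>j. of_real (b j)) \<xi> \<xi>) + (- 1 / 2) * \<phi> (schmidt_op c \<xi> \<xi>)"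
    using trace_schmidt_op_lincomb[OF ons ons db dc, of 1 "- 1 / 2"] by simp
  also have "\<phi> (schmidt_op c \<xi> \<xi>) = 2 * \<phi> (schmidt_op (\<lambda>j. of_real (b j)) \<xi> \<xi>)"
    using trace_two_copies[OF \<xi> db] dc unfolding c_def by simp
  finally show ?thesis by simp
qed

end


section \<open>Traces of compressions of commutators\<close>

text \<open>
  A condition on \<open>X\<close> that survives sums, holds for commutators and controls the partial sums of the
  diagonal of \<open>X\<close>.  The freedom in choosing \<open>B\<close> above the exceptional set \<open>F\<close> is what makes it
  additive.
\<close>

definition small_compressions :: "(real \<Rightarrow> real) \<Rightarrow> ('a::complex_hilbert \<Rightarrow> 'a) \<Rightarrow> bool" where
  "small_compressions g X \<longleftrightarrow> (\<exists>m C. \<forall>n. \<exists>F. finite F \<and> card F \<le> m * n \<and>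
     (\<forall>B. finite B \<and> orthonormal_set B \<and> F \<subseteq> cspan B \<longrightarrow>
        cmod (\<Sum>b\<in>B. cinner (X b) b) \<le> C * real (card B) * g (real n)))"

lemma small_compressions_zero: "small_compressions g (\<lambda>x. 0)"
  unfolding small_compressions_def by (intro exI[of _ 0] allI exI[of _ "{}"]) auto

lemma small_compressions_add:
  assumes "small_compressions g X" "small_compressions g Y"
  shows "small_compressions g (\<lambda>x. X x + Y x)"
proof -
  obtain m C where X: "\<And>n. \<exists>F. finite F \<and> card F \<le> m * n \<and>
     (\<forall>B. finite B \<and> orthonormal_set B \<and> F \<subseteq> cspan B \<longrightarrow>
        cmod (\<Sum>b\<in>B. cinner (X b) b) \<le> C * real (card B) * g (real n))"
    using assms(1) unfolding small_compressions_def by blast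
  obtain k D where Y: "\<And>n. \<exists>F. finite F \<and> card F \<le> k * n \<and>
     (\<forall>B. finite B \<and> orthonormal_set B \<and> F \<subseteq> cspan B \<longrightarrow>
        cmod (\<Sum>b\<in>B. cinner (Y b) b) \<le> D * real (card B) * g (real n))"
    using assms(2) unfolding small_compressions_def by blast
  show ?thesis
    unfolding small_compressions_def
  proof (intro exI[of _ "m + k"] exI[of _ "C + D"] allI)
    fix n
    obtain F where F: "finite F" "card F \<le> m * n"
      "\<And>B. finite B \<Longrightarrow> orthonormal_set B \<Longrightarrow> F \<subseteq> cspan B \<Longrightarrow>
        cmod (\<Sum>b\<in>B. cinner (X b) b) \<le> C * real (card B) * g (real n)"
      using X[of n] by blast
    obtain G where G: "finite G" "card G \<le> k * n"
      "\<And>B. finite B \<Longrightarrow> orthonormal_set B \<Longrightarrow> G \<subseteq> cspan B \<Longrightarrow>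
        cmod (\<Sum>b\<in>B. cinner (Y b) b) \<le> D * real (card B) * g (real n)"
      using Y[of n] by blast
    show "\<exists>F. finite F \<and> card F \<le> (m + k) * n \<and>
     (\<forall>B. finite B \<and> orthonormal_set B \<and> F \<subseteq> cspan B \<longrightarrow>
        cmod (\<Sum>b\<in>B. cinner (X b + Y b) b) \<le> (C + D) * real (card B) * g (real n))"
    proof (intro exI[of _ "F \<union> G"] conjI allI impI)
      show "card (F \<union> G) \<le> (m + k) * n"
        using card_Un_le[of F G] F(2) G(2) by (simp add: distrib_right)
      fix B assume "finite B \<and> orthonormal_set B \<and> F \<union> G \<subseteq> cspan B"
      then have "cmod (\<Sum>b\<in>B. cinner (X b) b) + cmod (\<Sum>b\<in>B. cinner (Y b) b)
          \<le> C * real (card B) * g (real n) + D * real (card B) * g (real n)"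
        by (intro add_mono F(3) G(3)) auto
      then show "cmod (\<Sum>b\<in>B. cinner (X b + Y b) b) \<le> (C + D) * real (card B) * g (real n)"
        using norm_triangle_ineq[of "\<Sum>b\<in>B. cinner (X b) b" "\<Sum>b\<in>B. cinner (Y b) b"]
        by (simp add: cinner_simps sum.distrib distrib_right)
    qed (use F(1) G(1) in simp)
  qed
qed

lemma small_compressions_scaleC:
  assumes "small_compressions g X"
  shows "small_compressions g (\<lambda>x. c *\<^sub>C X x)"
proof -
  obtain m C where X: "\<And>n. \<exists>F. finite F \<and> card F \<le> m * n \<and>
     (\<forall>B. finite B \<and> orthonormal_set B \<and> F \<subseteq> cspan B \<longrightarrow>
        cmod (\<Sum>b\<in>B. cinner (X b) b) \<le> C * real (card B) * g (real n))"
    using assms unfolding small_compressions_def by blast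
  have *: "cmod (\<Sum>b\<in>B. cinner (c *\<^sub>C X b) b) \<le> (cmod c * C) * real (card B) * g (real n)"
    if "cmod (\<Sum>b\<in>B. cinner (X b) b) \<le> C * real (card B) * g (real n)" for B n
    using mult_left_mono[OF that, of "cmod c"]
    by (simp add: cinner_simps norm_mult mult.assoc flip: sum_distrib_left)
  show ?thesis
    unfolding small_compressions_def
  proof (intro exI[of _ m] exI[of _ "cmod c * C"] allI)
    fix n
    obtain F where "finite F" "card F \<le> m * n"
      "\<And>B. finite B \<and> orthonormal_set B \<and> F \<subseteq> cspan B \<Longrightarrow>
        cmod (\<Sum>b\<in>B. cinner (X b) b) \<le> C * real (card B) * g (real n)"
      using X[of n] by blast
    then show "\<exists>F. finite F \<and> card F \<le> m * n \<and>
     (\<forall>B. finite B \<and> orthonormal_set B \<and> F \<subseteq> cspan B \<longrightarrow>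
        cmod (\<Sum>b\<in>B. cinner (c *\<^sub>C X b) b) \<le> (cmod c * C) * real (card B) * g (real n))"
      by (intro exI[of _ F] conjI allI impI *)
  qed
qed

text \<open>
  The trace of \<open>[A, T']\<close> compressed to the span of \<open>B\<close> vanishes when the finite-rank part
  \<open>T'\<close> of \<open>T\<close> lives on that span, and the remainder of \<open>T\<close> has norm \<open>O(g(n))\<close>.
\<close>

lemma small_compressions_commutator:
  assumes A: "bounded_clinear A" and app: "approximable g T"
  shows "small_compressions g (\<lambda>x. A (T x) - T (A x))"
proof -
  obtain K where K: "K > 0" "\<And>x. norm (A x) \<le> K * norm x"
    using bounded_clinear_bound[OF A] by blast
  obtain C where C: "\<And>n::nat. \<exists>u v. \<forall>x.
      norm (T x - (\<Sum>i<n. cinner x (u i) *\<^sub>C v i)) \<le> C * g (real n) * norm x"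
    using app unfolding approximable_def by blast
  show ?thesis
    unfolding small_compressions_def
  proof (intro exI[of _ "2 :: nat"] exI[of _ "2 * K * C"] allI)
    fix n
    obtain u v where uv: "\<And>x. norm (T x - (\<Sum>i<n. cinner x (u i) *\<^sub>C v i)) \<le> C * g (real n) * norm x"
      using C[of n] by blast
    define F where "F = u ` {..<n} \<union> v ` {..<n}"
    define T' where "T' x = (\<Sum>i<n. cinner x (u i) *\<^sub>C v i)" for x
    define R where "R x = T x - T' x" for x
    have R: "norm (R x) \<le> C * g (real n) * norm x" for x using uv by (simp add: R_def T'_def)
    have "card F \<le> card (u ` {..<n}) + card (v ` {..<n})"
      unfolding F_def by (rule card_Un_le)
    also have "\<dots> \<le> 2 * n"
      using card_image_le[of "{..<n}" u] card_image_le[of "{..<n}" v] by simp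
    finally have card_F: "card F \<le> 2 * n" .
    have "cmod (\<Sum>b\<in>B. cinner (A (T b) - T (A b)) b) \<le> 2 * K * C * real (card B) * g (real n)"
      if B: "finite B" "orthonormal_set B" "F \<subseteq> cspan B" for B
    proof -
      have u: "u i \<in> cspan B" and v: "v i \<in> cspan B" if "i < n" for i
        using B(3) that by (auto simp: F_def)
      have "(\<Sum>b\<in>B. cinner (A (T' b)) b) = (\<Sum>i<n. \<Sum>b\<in>B. cinner (A (v i)) b * cinner b (u i))"
        by (subst sum.swap) (simp add: T'_def bounded_clinear_sum[OF A] bounded_clinear_scaleC[OF A]
            cinner.sum_left cinner_simps mult.commute)
      also have "\<dots> = (\<Sum>i<n. cinner (A (v i)) (u i))"
        using u by (intro sum.cong parseval_finite B) auto
      also have "\<dots> = (\<Sum>i<n. cinner (A (\<Sum>b\<in>B. cinner (v i) b *\<^sub>C b)) (u i))"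
        using v by (intro sum.cong) (simp_all add: parseval_in_span[OF B(1,2)])
      also have "\<dots> = (\<Sum>i<n. \<Sum>b\<in>B. cinner (v i) b * cinner (A b) (u i))"
        by (simp add: bounded_clinear_sum[OF A] bounded_clinear_scaleC[OF A] cinner.sum_left cinner_simps)
      also have "\<dots> = (\<Sum>b\<in>B. \<Sum>i<n. cinner (v i) b * cinner (A b) (u i))" by (rule sum.swap)
      also have "\<dots> = (\<Sum>b\<in>B. cinner (T' (A b)) b)"
        by (simp add: T'_def cinner.sum_left cinner_simps mult.commute)
      finally have "(\<Sum>b\<in>B. cinner (A (T' b)) b) = (\<Sum>b\<in>B. cinner (T' (A b)) b)" .
      moreover have "cinner (A (T b) - T (A b)) b
          = cinner (A (T' b)) b - cinner (T' (A b)) b + (cinner (A (R b)) b - cinner (R (A b)) b)" for b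
        by (simp add: R_def bounded_clinear_diff[OF A] cinner_simps)
      ultimately have "(\<Sum>b\<in>B. cinner (A (T b) - T (A b)) b)
          = (\<Sum>b\<in>B. cinner (A (R b)) b - cinner (R (A b)) b)"
        by (simp add: sum.distrib sum_subtractf)
      also have "cmod \<dots> \<le> (\<Sum>b\<in>B. 2 * K * C * g (real n))"
      proof (rule sum_norm_le)
        fix b assume "b \<in> B"
        then have b: "norm b = 1" using orthonormal_set_norm[OF B(2)] by blast
        have "0 \<le> C * g (real n)" using order_trans[OF norm_ge_zero R[of b]] b by simp
        have "cmod (cinner (A (R b)) b) \<le> norm (A (R b))"
          using norm_cinner_le[of "A (R b)" b] b by simp
        also have "\<dots> \<le> K * norm (R b)" by (rule K)
        also have "\<dots> \<le> K * (C * g (real n))"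
          using R[of b] b K(1) by (intro mult_left_mono) auto
        finally have 1: "cmod (cinner (A (R b)) b) \<le> K * (C * g (real n))" .
        have "cmod (cinner (R (A b)) b) \<le> norm (R (A b))"
          using norm_cinner_le[of "R (A b)" b] b by simp
        also have "\<dots> \<le> C * g (real n) * norm (A b)" by (rule R)
        also have "\<dots> \<le> C * g (real n) * K"
          using K(2)[of b] b \<open>0 \<le> C * g (real n)\<close> by (intro mult_left_mono) auto
        finally have 2: "cmod (cinner (R (A b)) b) \<le> K * (C * g (real n))" by (simp add: mult_ac)
        show "cmod (cinner (A (R b)) b - cinner (R (A b)) b) \<le> 2 * K * C * g (real n)"
          using norm_triangle_ineq4[of "cinner (A (R b)) b" "cinner (R (A b)) b"] 1 2 by simp
      qed
      finally show ?thesis by (simp add: mult_ac)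
    qed
    moreover have "finite F" by (simp add: F_def)
    ultimately show "\<exists>F. finite F \<and> card F \<le> 2 * n \<and>
     (\<forall>B. finite B \<and> orthonormal_set B \<and> F \<subseteq> cspan B \<longrightarrow>
        cmod (\<Sum>b\<in>B. cinner (A (T b) - T (A b)) b) \<le> 2 * K * C * real (card B) * g (real n))"
      using card_F by blast
  qed
qed

text \<open>
  The basis vectors of \<open>B\<close> beyond \<open>\<xi>\<^sub>0, \<dots>, \<xi>\<^bsub>n-1\<^esub>\<close> number at most \<open>m n\<close>, and on
  their span a diagonal operator with entries \<open>O(g(j))\<close> has norm \<open>O(g(n))\<close>.
\<close>

lemma small_compressions_diagonal:
  assumes \<xi>: "orthonormal_seq \<xi>" and g: "\<And>j. g (real j) > 0"
    and M: "\<And>i j. i \<le> j \<Longrightarrow> g (real j) \<le> M * g (real i)"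
    and w: "dominated g w" and small: "small_compressions g (schmidt_op w \<xi> \<xi>)"
  obtains K where "\<And>n. cmod (\<Sum>j<n. w j) \<le> K * real n * g (real n)"
proof -
  define X where "X = schmidt_op w \<xi> \<xi>"
  obtain m C where mC: "\<And>n. \<exists>F. finite F \<and> card F \<le> m * n \<and>
     (\<forall>B. finite B \<and> orthonormal_set B \<and> F \<subseteq> cspan B \<longrightarrow>
        cmod (\<Sum>b\<in>B. cinner (X b) b) \<le> C * real (card B) * g (real n))"
    using small unfolding small_compressions_def X_def by blast
  obtain D where D: "D \<ge> 0" "\<And>j. cmod (w j) \<le> D * g (real j)"
    using w by (auto simp: dominated_def)
  have w_le: "cmod (w j) \<le> D * M * g (real n)" if "n \<le> j" for n j
    using D(2)[of j] mult_left_mono[OF M[OF that] D(1)] by (simp add: mult.assoc)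
  have "cmod (\<Sum>j<n. w j) \<le> (\<bar>C\<bar> * real (m + 1) + D * M * real m) * real n * g (real n)" for n
  proof -
    obtain F where F: "finite F" "card F \<le> m * n"
      "\<And>B. finite B \<Longrightarrow> orthonormal_set B \<Longrightarrow> F \<subseteq> cspan B \<Longrightarrow>
        cmod (\<Sum>b\<in>B. cinner (X b) b) \<le> C * real (card B) * g (real n)"
      using mC[of n] by blast
    define N where "N = \<xi> ` {..<n}"
    have inj: "inj_on \<xi> {..<n}" using orthonormal_seq_inj[OF \<xi>] by (rule inj_on_subset) simp
    have N: "finite N" "orthonormal_set N" "card N = n"
      using orthonormal_seq_image[OF \<xi>] card_image[OF inj] by (simp_all add: N_def)
    obtain B where B: "N \<subseteq> B" "finite B" "orthonormal_set B" "F \<subseteq> cspan B" "card B \<le> card N + card F"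
      using gram_schmidt_extend[OF F(1) N(1,2)] by blast
    have card_B: "card B \<le> (m + 1) * n" using B(5) F(2) N(3) by simp
    have card_BN: "card (B - N) \<le> m * n"
      using card_Diff_subset[OF N(1) B(1)] B(5) F(2) by simp
    have nonneg: "0 \<le> D * M * g (real n)" by (rule order_trans[OF norm_ge_zero w_le[OF order_refl]])
    have rest: "cmod (\<Sum>b\<in>B - N. cinner (X b) b) \<le> (\<Sum>b\<in>B - N. D * M * g (real n))"
    proof (rule sum_norm_le)
      fix b assume b: "b \<in> B - N"
      have "cinner b (\<xi> j) = 0" if "j < n" for j
      proof -
        have "\<xi> j \<in> N" using that by (simp add: N_def)
        then show ?thesis using b B(1) orthonormal_setD[OF B(3), of b "\<xi> j"] by auto
      qed
      then have "norm (X b) \<le> D * M * g (real n) * norm b"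
        unfolding X_def by (intro schmidt_op_norm_le \<xi> nonneg w_le) (meson not_le)
      then show "cmod (cinner (X b) b) \<le> D * M * g (real n)"
        using norm_cinner_le[of "X b" b] orthonormal_set_norm[OF B(3), of b] b by simp
    qed
    have "(\<Sum>b\<in>N. cinner (X b) b) = (\<Sum>j<n. w j)"
      unfolding N_def sum.reindex[OF inj]
      by (simp add: X_def schmidt_op_basis[OF \<xi> \<xi>] cinner_simps orthonormal_seqD[OF \<xi>])
    then have "(\<Sum>j<n. w j) = (\<Sum>b\<in>B. cinner (X b) b) - (\<Sum>b\<in>B - N. cinner (X b) b)"
      using sum.subset_diff[OF B(1,2), of "\<lambda>b. cinner (X b) b"] by simp
    then have "cmod (\<Sum>j<n. w j)
        \<le> C * real (card B) * g (real n) + real (card (B - N)) * (D * M * g (real n))"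
      using norm_triangle_ineq4[of "\<Sum>b\<in>B. cinner (X b) b" "\<Sum>b\<in>B - N. cinner (X b) b"]
        F(3)[OF B(2-4)] rest by simp
    also have "C * real (card B) * g (real n) \<le> \<bar>C\<bar> * real ((m + 1) * n) * g (real n)"
      using card_B less_imp_le[OF g[of n]] by (intro mult_right_mono mult_mono) (auto simp del: of_nat_mult)
    also have "real (card (B - N)) * (D * M * g (real n)) \<le> real (m * n) * (D * M * g (real n))"
      using card_BN nonneg by (intro mult_right_mono) (auto simp del: of_nat_mult)
    finally show ?thesis by (simp add: algebra_simps)
  qed
  then show ?thesis by (rule that)
qed


section \<open>Existence of traces\<close>

text \<open>The complex vector space of all maps on the Hilbert space, under pointwise operations.\<close>

interpretation op_space: vector_space
  "(\<lambda>c T x. c *\<^sub>C T x) :: complex \<Rightarrow> ('a::complex_hilbert \<Rightarrow> 'a) \<Rightarrow> 'a \<Rightarrow> 'a"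
  by unfold_locales (auto simp: fun_eq_iff scaleC_add_left scaleC_add_right scaleC_scaleC)

lemma small_compressions_span_commutators:
  assumes "\<And>T. T \<in> I \<Longrightarrow> approximable g T" "X \<in> op_space.span (commutators I)"
  shows "small_compressions g X"
  using assms(2)
proof (induction rule: op_space.span_induct_alt)
  case base
  then show ?case using small_compressions_zero by (simp add: zero_fun_def)
next
  case (step c X Y)
  then have "small_compressions g X"
    unfolding commutators_def using small_compressions_commutator assms(1) by blast
  then show ?case
    using small_compressions_add[OF small_compressions_scaleC step(2)] by (simp add: plus_fun_def)
qed

text \<open>
  Independence modulo the commutators allows to extend a basis of their span by \<open>P\<close> and \<open>Q\<close>;
  a linear functional may then be prescribed on the larger independent set.
\<close>

lemma trace_with_prescribed_values:
  fixes P Q :: "'a::complex_hilbert \<Rightarrow> 'a"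
  assumes indep: "\<And>\<alpha> \<beta>. (\<lambda>x. \<alpha> *\<^sub>C P x + \<beta> *\<^sub>C Q x) \<in> op_space.span (commutators I) \<Longrightarrow> \<alpha> = 0 \<and> \<beta> = 0"
  obtains \<phi> where "trace_on I \<phi>" "\<phi> P = p" "\<phi> Q = q"
proof -
  interpret functionals: vector_space_pair
    "(\<lambda>c T x. c *\<^sub>C T x) :: complex \<Rightarrow> ('a \<Rightarrow> 'a) \<Rightarrow> 'a \<Rightarrow> 'a" "(*) :: complex \<Rightarrow> complex \<Rightarrow> complex"
    by unfold_locales (auto simp: algebra_simps)
  obtain B where B: "B \<subseteq> commutators I" "op_space.independent B" "commutators I \<subseteq> op_space.span B"
    by (rule op_space.maximal_independent_subset)
  have spanB: "op_space.span B \<subseteq> op_space.span (commutators I)"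
    by (rule op_space.span_mono[OF B(1)])
  have Q: "Q \<notin> op_space.span B"
    using indep[of 0 1] spanB by auto
  have P: "P \<notin> op_space.span (insert Q B)"
  proof
    assume "P \<in> op_space.span (insert Q B)"
    then obtain k where k: "P - (\<lambda>x. k *\<^sub>C Q x) \<in> op_space.span B"
      using op_space.span_breakdown_eq by blast
    have "P - (\<lambda>x. k *\<^sub>C Q x) = (\<lambda>x. 1 *\<^sub>C P x + (- k) *\<^sub>C Q x)"
      by (auto simp: fun_eq_iff fun_diff_def scaleC.minus_left)
    then show False using k spanB indep[of 1 "- k"] by auto
  qed
  have ind: "op_space.independent (insert P (insert Q B))"
    by (intro op_space.independent_insertI P Q B)
  define f where "f X = (if X = P then p else if X = Q then q else 0)" for X
  obtain \<phi> where lin: "Vector_Spaces.linear (\<lambda>c T x. c *\<^sub>C T x) (*) \<phi>"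
    and \<phi>: "\<And>X. X \<in> insert P (insert Q B) \<Longrightarrow> \<phi> X = f X"
    using functionals.linear_independent_extend[OF ind, of f] by blast
  have neq: "P \<noteq> Q" "P \<notin> B" "Q \<notin> B"
    using P Q op_space.span_base by blast+
  have zero: "\<phi> X = 0" if "X \<in> commutators I" for X
  proof (rule functionals.linear_eq_0_on_span[OF lin])
    show "X \<in> op_space.span B" using that B(3) by blast
    show "\<phi> Y = 0" if "Y \<in> B" for Y using \<phi>[of Y] that neq by (auto simp: f_def)
  qed
  have "trace_on I \<phi>"
    unfolding trace_on_def
  proof (intro conjI ballI allI impI)
    show "\<phi> (\<lambda>x. S x + T x) = \<phi> S + \<phi> T" for S T
      using functionals.linear_add[OF lin, of S T] by (simp add: plus_fun_def)
    show "\<phi> (\<lambda>x. c *\<^sub>C T x) = c * \<phi> T" for c T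
      using functionals.linear_scale[OF lin, of c T] by simp
    show "\<phi> (\<lambda>x. A (T x) - T (A x)) = 0" if "T \<in> I" "bounded_clinear A" for A T
      using that by (intro zero) (auto simp: commutators_def)
  qed
  moreover have "\<phi> P = p" "\<phi> Q = q" using \<phi>[of P] \<phi>[of Q] neq by (auto simp: f_def)
  ultimately show ?thesis by (rule that)
qed


section \<open>Hypermeasurability of the model operators\<close>

text \<open>
  On three separated scales, \<open>h = o(E)\<close> and \<open>E = o(G)\<close>, the coefficients of a combination of
  \<open>G\<close> and \<open>E\<close> that is as small as \<open>h\<close> vanish one after the other.
\<close>

lemma independent_growth:
  fixes E G h :: "nat \<Rightarrow> real" and \<alpha> \<beta> :: complex
  assumes hE: "\<And>c. c > 0 \<Longrightarrow> \<forall>\<^sub>F n in sequentially. h n \<le> c * E n"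
    and EG: "\<And>c. c > 0 \<Longrightarrow> \<forall>\<^sub>F n in sequentially. E n \<le> c * G n"
    and E: "\<forall>\<^sub>F n in sequentially. E n > 0" and h: "\<And>n. h n \<ge> 0"
    and le: "\<And>n. cmod (\<alpha> * of_real (G n) + \<beta> * of_real (E n)) \<le> K * h n"
  shows "\<alpha> = 0 \<and> \<beta> = 0"
proof -
  have le': "cmod (\<alpha> * of_real (G n) + \<beta> * of_real (E n)) \<le> (\<bar>K\<bar> + 1) * h n" for n
    using le[of n] mult_right_mono[of K "\<bar>K\<bar> + 1" "h n"] h[of n] by linarith
  have \<alpha>: "\<alpha> = 0"
  proof (rule ccontr)
    assume "\<alpha> \<noteq> 0"
    define c where "c = cmod \<alpha> / (2 * (cmod \<beta> + 1))"
    have "cmod \<beta> + 1 > 0" by (simp add: add_nonneg_pos)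
    then have c: "c > 0" "(cmod \<beta> + 1) * c = cmod \<alpha> / 2"
      using \<open>\<alpha> \<noteq> 0\<close> by (simp_all add: c_def field_simps)
    have K1: "1 / (\<bar>K\<bar> + 1) > 0" by (simp add: add_nonneg_pos)
    have "\<forall>\<^sub>F n in sequentially. False"
      using hE[OF K1] EG[OF c(1)] E
    proof eventually_elim
      case (elim n)
      have "G n > 0" using elim(2,3) c(1) by (smt (verit) zero_less_mult_pos)
      have "(\<bar>K\<bar> + 1) * h n \<le> E n" using elim(1) by (simp add: field_simps)
      have "cmod (\<alpha> * of_real (G n)) \<le> cmod (\<alpha> * of_real (G n) + \<beta> * of_real (E n)) + cmod (\<beta> * of_real (E n))"
        by (metis add_diff_cancel_right' norm_triangle_ineq4)
      then have "cmod \<alpha> * G n \<le> E n + cmod \<beta> * E n"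
        using le'[of n] \<open>(\<bar>K\<bar> + 1) * h n \<le> E n\<close> \<open>G n > 0\<close> elim(3) by (simp add: norm_mult)
      also have "\<dots> = (cmod \<beta> + 1) * E n" by (simp add: algebra_simps)
      also have "\<dots> \<le> (cmod \<beta> + 1) * (c * G n)" using elim(2) by (intro mult_left_mono) auto
      also have "\<dots> = cmod \<alpha> / 2 * G n" by (simp only: mult.assoc[symmetric] c(2))
      finally show False using \<open>\<alpha> \<noteq> 0\<close> \<open>G n > 0\<close> by simp
    qed
    then show False by simp
  qed
  have "\<beta> = 0"
  proof (rule ccontr)
    assume "\<beta> \<noteq> 0"
    then have "cmod \<beta> / (2 * (\<bar>K\<bar> + 1)) > 0" by (simp add: add_nonneg_pos)
    from hE[OF this] E have "\<forall>\<^sub>F n in sequentially. False"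
    proof eventually_elim
      case (elim n)
      have "cmod \<beta> * E n \<le> (\<bar>K\<bar> + 1) * h n"
        using le'[of n] elim(2) by (simp add: \<alpha> norm_mult)
      also have "\<dots> \<le> (\<bar>K\<bar> + 1) * (cmod \<beta> / (2 * (\<bar>K\<bar> + 1)) * E n)"
        using elim(1) by (intro mult_left_mono) auto
      also have "\<dots> = cmod \<beta> / 2 * E n"
        by (simp add: add_nonneg_pos field_simps)
      finally show False using \<open>\<beta> \<noteq> 0\<close> elim(2) by simp
    qed
    then show False by simp
  qed
  with \<alpha> show ?thesis by blast
qed

text \<open>
  The terms with \<open>\<epsilon>\<^sub>j \<ge> c/2\<close> are finitely many, and the sums of \<open>g\<close> outgrow their total.
\<close>

lemma weighted_sum_negligible:
  fixes g \<epsilon> :: "nat \<Rightarrow> real"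
  assumes g: "\<And>j. g j > 0" and G: "filterlim (\<lambda>n. \<Sum>j<n. g j) at_top sequentially"
    and \<epsilon>: "\<epsilon> \<longlonglongrightarrow> 0" and "c > 0"
  shows "\<forall>\<^sub>F n in sequentially. (\<Sum>j<n. \<epsilon> j * g j) \<le> c * (\<Sum>j<n. g j)"
proof -
  obtain N where N: "\<And>j. j \<ge> N \<Longrightarrow> \<epsilon> j < c / 2"
    using order_tendstoD(2)[OF \<epsilon>, of "c / 2"] \<open>c > 0\<close> by (auto simp: eventually_sequentially)
  define D where "D = (\<Sum>j<N. \<epsilon> j * g j)"
  have *: "(\<Sum>j<n. \<epsilon> j * g j) \<le> D + c / 2 * (\<Sum>j<n. g j)" if "n \<ge> N" for n
  proof -
    have *: "{..<n} = {..<N} \<union> {N..<n}" using that by auto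
    have split: "(\<Sum>j<n. f j) = (\<Sum>j<N. f j) + (\<Sum>j=N..<n. f j)" for f :: "nat \<Rightarrow> real"
      unfolding * by (rule sum.union_disjoint) auto
    have "(\<Sum>j=N..<n. \<epsilon> j * g j) \<le> (\<Sum>j=N..<n. c / 2 * g j)"
      using N g by (intro sum_mono mult_right_mono) (auto intro: less_imp_le)
    also have "\<dots> = c / 2 * (\<Sum>j=N..<n. g j)" by (simp add: sum_distrib_left)
    also have "\<dots> \<le> c / 2 * (\<Sum>j<n. g j)"
      using \<open>c > 0\<close> g by (intro mult_left_mono sum_mono2) (auto intro: less_imp_le)
    finally show ?thesis using split[of "\<lambda>j. \<epsilon> j * g j"] by (simp add: D_def)
  qed
  have "\<forall>\<^sub>F n in sequentially. D / (c / 2) \<le> (\<Sum>j<n. g j)"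
    using G by (simp add: filterlim_at_top)
  then show ?thesis
    using eventually_ge_at_top[of N]
  proof eventually_elim
    case (elim n)
    have "D \<le> c / 2 * (\<Sum>j<n. g j)"
      using elim(1) \<open>c > 0\<close> by (simp add: pos_divide_le_eq mult.commute)
    then show ?case using *[OF elim(2)] by (simp add: field_simps)
  qed
qed

lemma model_operator_eq_schmidt_op:
  assumes "model_operator g T" "bounded (range (\<lambda>j. g (real j)))"
  obtains \<xi> where "orthonormal_basis \<xi>" "T = schmidt_op (\<lambda>j. of_real (g (real j))) \<xi> \<xi>"
proof -
  obtain \<xi> where T: "bounded_clinear T" and \<xi>: "orthonormal_basis \<xi>"
    and eig: "\<And>j. T (\<xi> j) = g (real j) *\<^sub>R \<xi> j"
    using assms(1) by (auto simp: model_operator_def)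
  have ons: "orthonormal_seq \<xi>" using \<xi> by (rule orthonormal_basis_seq)
  have bdd: "bounded (range (\<lambda>j. complex_of_real (g (real j))))"
    using assms(2) by (auto simp: bounded_iff)
  have "T = schmidt_op (\<lambda>j. of_real (g (real j))) \<xi> \<xi>"
    by (rule bounded_clinear_eq_on_dense[OF T schmidt_op_bounded_clinear[OF ons ons bdd], of "range \<xi>"])
      (use \<xi> in \<open>auto simp: orthonormal_basis_def eig schmidt_op_basis[OF ons ons] scaleC_of_real\<close>)
  then show ?thesis using \<xi> that by blast
qed

lemma hypermeasurable_cong:
  assumes "\<And>\<phi>. trace_on I \<phi> \<Longrightarrow> \<phi> N = 1 \<longleftrightarrow> \<phi> N' = 1"
  shows "hypermeasurable I N = hypermeasurable I N'"
  using assms by (auto simp: hypermeasurable_def)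

lemma weak_lorentz_eqI:
  assumes g: "\<And>t. t \<ge> 0 \<Longrightarrow> g t > 0" and "c > 0"
    and le: "\<And>t. t \<ge> 0 \<Longrightarrow> g t \<le> g' t" "\<And>t. t \<ge> 0 \<Longrightarrow> g' t \<le> c * g t"
  shows "weak_lorentz g = weak_lorentz g'"
proof -
  have "(\<lambda>j. g (real j)) \<in> \<Theta>(\<lambda>j. g' (real j))"
  proof (rule bigthetaI)
    show "(\<lambda>j. g (real j)) \<in> O(\<lambda>j. g' (real j))"
    proof (rule landau_o.bigI[OF zero_less_one], intro always_eventually allI)
      show "norm (g (real j)) \<le> 1 * norm (g' (real j))" for j
        using le(1)[of "real j"] g[of "real j"] by simp
    qed
    show "(\<lambda>j. g (real j)) \<in> \<Omega>(\<lambda>j. g' (real j))"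
      unfolding bigomega_iff_bigo
    proof (rule landau_o.bigI[OF \<open>c > 0\<close>], intro always_eventually allI)
      show "norm (g' (real j)) \<le> c * norm (g (real j))" for j
        using le[of "real j"] g[of "real j"] by simp
    qed
  qed
  then show ?thesis by (simp add: weak_lorentz_def landau_o.big.cong_bigtheta)
qed

theorem proposition3p16:
  fixes g g1 \<epsilon> :: "real \<Rightarrow> real"
    and Tg Tg1 :: "'a::complex_hilbert \<Rightarrow> 'a"
  assumes separable: "separable_space (euclidean :: 'a topology)"
    and infinite_dim: "\<not> (\<exists>B :: 'a set. finite B \<and> cspan B = UNIV)"
    and g_RV: "RV_minus_one g"
    and g_int: "filterlim (\<lambda>t. integral {0..t} g) at_top at_top"
    and g_lower: "(\<lambda>t. inverse t) \<in> O[at_top](g)"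
    and g1_RV: "RV_minus_one g1"
    and g1_eq: "\<forall>t\<ge>0. g1 t = g t * (1 + \<epsilon> t)"
    and eps_cont: "continuous_on {0..} \<epsilon>"
    and eps_pos: "\<forall>t\<ge>0. \<epsilon> t > 0"
    and eps_decreasing: "antimono_on {0..} \<epsilon>"
    and eps_lim: "(\<epsilon> \<longlongrightarrow> 0) at_top"
    and Tg: "model_operator g Tg"
    and Tg1: "model_operator g1 Tg1"
  shows "(weak_lorentz g1 :: ('a \<Rightarrow> 'a) set) = weak_lorentz g \<and>
    ((\<lambda>t. integral {0..t} (\<lambda>s. \<epsilon> s * g s)) \<in> O[at_top](\<lambda>t. t * g t) \<longrightarrow>
      (\<forall>\<phi>. trace_on (weak_lorentz g) \<phi> \<longrightarrow> (\<phi> Tg = 1 \<longleftrightarrow> \<phi> Tg1 = 1)) \<and>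
      hypermeasurable (weak_lorentz g) Tg1 = hypermeasurable (weak_lorentz g) Tg) \<and>
    ((\<lambda>t. t * g t) \<in> o[at_top](\<lambda>t. integral {0..t} (\<lambda>s. \<epsilon> s * g s)) \<longrightarrow>
      Tg1 \<notin> hypermeasurable (weak_lorentz g) Tg \<and>
      Tg \<notin> hypermeasurable (weak_lorentz g) Tg1 \<and>
      hypermeasurable (weak_lorentz g) Tg1 \<noteq> hypermeasurable (weak_lorentz g) Tg)"
proof -
  have g_pos: "g t > 0" if "t \<ge> 0" for t using g_RV that by (simp add: RV_minus_one_def)
  have g_cont: "continuous_on {0..} g" using g_RV by (simp add: RV_minus_one_def)
  obtain M where M: "M > 0" "\<And>s t. 0 \<le> s \<Longrightarrow> s \<le> t \<Longrightarrow> g t \<le> M * g s"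
    by (rule RV_minus_one_quasi_antimono[OF g_RV]) (rule that)
  have g_pos': "g (real j) > 0" for j using g_pos by simp
  have M': "g (real j) \<le> M * g (real i)" if "i \<le> j" for i j using M(2) that by simp
  have g_lim: "(\<lambda>n. g (real n)) \<longlonglongrightarrow> 0"
    by (rule filterlim_compose[OF RV_minus_one_tendsto_0[OF g_RV] filterlim_real_sequentially])
  have eps_le: "\<epsilon> t \<le> \<epsilon> s" if "0 \<le> s" "s \<le> t" for s t
    using monotone_onD[OF eps_decreasing, of s t] that by simp
  have g1_le: "g t \<le> g1 t" "g1 t \<le> (1 + \<epsilon> 0) * g t" if "t \<ge> 0" for t
  proof -
    have "0 < \<epsilon> t" "\<epsilon> t \<le> \<epsilon> 0" using eps_pos eps_le[of 0 t] that by auto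
    then show "g t \<le> g1 t" "g1 t \<le> (1 + \<epsilon> 0) * g t"
      using g1_eq g_pos[OF that] that by (simp_all add: algebra_simps)
  qed
  have "0 < 1 + \<epsilon> 0" using eps_pos by (simp add: add_pos_pos)
  then have ideals: "(weak_lorentz g1 :: ('a \<Rightarrow> 'a) set) = weak_lorentz g"
    by (intro weak_lorentz_eqI[of g "1 + \<epsilon> 0" g1, symmetric] g_pos g1_le)
  define I where "I = (weak_lorentz g :: ('a \<Rightarrow> 'a) set)"

  (* The diagonal of the difference of the model operators, when both use the same basis. *)
  define a where "a t = \<epsilon> t * g t" for t
  have a_pos: "a t > 0" if "t \<ge> 0" for t using eps_pos g_pos that by (simp add: a_def)
  have a_le: "a t \<le> M * a s" if "0 \<le> s" "s \<le> t" for s t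
  proof -
    have "a t \<le> \<epsilon> s * (M * g s)"
      unfolding a_def using that eps_le eps_pos M g_pos[of t] by (intro mult_mono) (auto intro: less_imp_le)
    then show ?thesis by (simp add: a_def mult_ac)
  qed
  have a_cont: "continuous_on {0..} a"
    unfolding a_def using eps_cont g_cont by (intro continuous_intros)
  have g1_sum: "g1 (real j) = g (real j) + a (real j)" for j
    using g1_eq by (simp add: a_def algebra_simps)
  have dom_g: "dominated g (\<lambda>j. of_real (g (real j)))"
    by (rule dominatedI[of _ _ 1]) (use g_pos in \<open>auto intro: less_imp_le\<close>)
  have dom_a: "dominated g (\<lambda>j. of_real (a (real j)))"
  proof (rule dominatedI[of _ _ "\<epsilon> 0"])
    fix j
    have "a (real j) \<le> \<epsilon> 0 * g (real j)"
      unfolding a_def using less_imp_le[OF g_pos[of "real j"]] by (intro mult_right_mono eps_le) auto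
    then show "cmod (of_real (a (real j))) \<le> \<epsilon> 0 * g (real j)"
      using a_pos[of "real j"] by simp
  qed (simp add: g_pos)
  have dom_g1: "dominated g (\<lambda>j. of_real (g1 (real j)))"
    using dominated_lincomb[OF dom_g dom_a, of 1 1] by (simp add: g1_sum)
  have bdd: "bounded (range w)" if "dominated g w" for w
    using dominated_bounded[OF that M'] .

  obtain \<xi> :: "nat \<Rightarrow> 'a" where \<xi>: "orthonormal_basis \<xi>"
    and Tg_eq: "Tg = schmidt_op (\<lambda>j. of_real (g (real j))) \<xi> \<xi>"
    using model_operator_eq_schmidt_op[OF Tg] bdd[OF dom_g] by (auto simp: bounded_iff)
  obtain \<eta> :: "nat \<Rightarrow> 'a" where \<eta>: "orthonormal_basis \<eta>"
    and Tg1_eq: "Tg1 = schmidt_op (\<lambda>j. of_real (g1 (real j))) \<eta> \<eta>"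
    using model_operator_eq_schmidt_op[OF Tg1] bdd[OF dom_g1] by (auto simp: bounded_iff)
  have ons: "orthonormal_seq \<xi>" "orthonormal_seq \<eta>"
    using \<xi> \<eta> by (auto intro: orthonormal_basis_seq)
  have I_iff: "T \<in> I \<longleftrightarrow> bounded_clinear T \<and> approximable g T" for T
    unfolding I_def by (rule weak_lorentz_iff_approximable[OF infinite_dim \<xi> g_pos g_lim])
  have in_I: "schmidt_op w e f \<in> I"
    if e: "orthonormal_seq e" and f: "orthonormal_seq f" and w: "dominated g w" for w e f
    using schmidt_op_approximable[OF e f w M'] schmidt_op_bounded_clinear[OF e f bdd[OF w]]
    by (simp add: I_iff)
  have Tg1_I: "Tg1 \<in> I" unfolding Tg1_eq by (intro in_I ons dom_g1)
  have int_nonneg: "0 \<le> integral {0..real n} a" for n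
    using a_pos by (intro integral_nonneg integrable_continuous_real continuous_on_subset[OF a_cont])
      (auto intro: less_imp_le)

  have same_value: "\<phi> Tg1 = \<phi> Tg"
    if small: "(\<lambda>t. integral {0..t} a) \<in> O[at_top](\<lambda>t. t * g t)" and \<phi>: "trace_on I \<phi>" for \<phi>
  proof -
    obtain C where C: "\<forall>\<^sub>F t in at_top. norm (integral {0..t} a) \<le> C * norm (t * g t)"
      using small by (elim landau_o.bigE)
    obtain D where D: "\<forall>\<^sub>F t in at_top. norm (inverse t) \<le> D * norm (g t)"
      using g_lower by (elim landau_o.bigE)
    have "\<forall>\<^sub>F n in sequentially. norm (\<Sum>i\<le>n. a (real i))
        \<le> (a 0 * D + M * C) * norm (real (n + 1) * g (real n))"
      using eventually_compose_filterlim[OF C filterlim_real_sequentially]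
        eventually_compose_filterlim[OF D filterlim_real_sequentially] eventually_gt_at_top[of 0]
    proof eventually_elim
      case (elim n)
      have gn: "0 < g (real n)" by (simp add: g_pos)
      have sum_nonneg: "0 \<le> (\<Sum>i\<le>n. a (real i))" using a_pos by (intro sum_nonneg) (auto intro: less_imp_le)
      (* The lower bound on g lets the constant a 0 be absorbed. *)
      have 1: "1 \<le> D * (real n * g (real n))"
        using elim(2,3) gn by (simp add: field_simps)
      have 2: "integral {0..real n} a \<le> C * (real n * g (real n))"
        using elim(1) gn int_nonneg[of n] by simp
      have pos: "0 \<le> a 0 * D + M * C"
      proof -
        have "0 < real n * g (real n)" using elim(3) gn by simp
        then have "0 \<le> D" "0 \<le> C" using 1 2 int_nonneg[of n]
          by (smt (verit) mult_nonpos_nonneg, smt (verit) mult_neg_pos)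
        then show ?thesis using M(1) less_imp_le[OF a_pos[of 0]] by simp
      qed
      have "(\<Sum>i\<le>n. a (real i)) \<le> a 0 * 1 + M * integral {0..real n} a"
        using sum_le_integral[OF a_cont M(1) a_le, of n] by simp
      also have "\<dots> \<le> a 0 * (D * (real n * g (real n))) + M * (C * (real n * g (real n)))"
        using 1 2 M(1) less_imp_le[OF a_pos[of 0]] by (intro add_mono mult_left_mono) auto
      also have "\<dots> = (a 0 * D + M * C) * (real n * g (real n))" by (simp add: algebra_simps)
      also have "\<dots> \<le> (a 0 * D + M * C) * (real (n + 1) * g (real n))"
        using pos gn by (intro mult_left_mono mult_right_mono) auto
      finally show ?case using sum_nonneg gn by simp
    qed
    then have "(\<lambda>n. \<Sum>i\<le>n. a (real i)) \<in> O(\<lambda>n. real (n + 1) * g (real n))"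
      by (rule bigoI)
    then obtain K where "\<And>n. (\<Sum>i\<le>n. a (real i)) \<le> K * (real (n + 1) * g (real n))"
      using bigo_sequence_iff[of "\<lambda>n. \<Sum>i\<le>n. a (real i)" "\<lambda>n. real (n + 1) * g (real n)"] a_pos g_pos
      by (force intro: sum_nonneg less_imp_le)
    then have means: "(\<Sum>i\<le>n. a (real i)) \<le> K * real (n + 1) * g (real n)" for n
      by (simp add: mult.assoc)
    have "\<phi> (schmidt_op (\<lambda>j. of_real (a (real j))) \<xi> \<xi>) = 0"
      using a_pos a_le less_imp_le[OF a_pos]
      by (intro trace_vanishes_if_means_dominated[OF in_I bdd \<phi> \<xi> _ _ M(1) _ means] g_pos) auto
    moreover have "\<phi> Tg1 = \<phi> (schmidt_op (\<lambda>j. of_real (g1 (real j))) \<xi> \<xi>)"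
      unfolding Tg1_eq by (rule trace_diagonal_independent[OF in_I bdd \<phi> ons(2,1) dom_g1])
    moreover have "\<dots> = \<phi> Tg + \<phi> (schmidt_op (\<lambda>j. of_real (a (real j))) \<xi> \<xi>)"
      using trace_schmidt_op_lincomb[OF in_I bdd \<phi> ons(1,1) dom_g dom_a, of 1 1]
      by (simp add: Tg_eq g1_sum)
    ultimately show ?thesis by simp
  qed

  have independent: "\<alpha> = 0 \<and> \<beta> = 0"
    if small: "(\<lambda>t. t * g t) \<in> o[at_top](\<lambda>t. integral {0..t} a)"
      and comm: "(\<lambda>x. \<alpha> *\<^sub>C Tg x + \<beta> *\<^sub>C Tg1 x) \<in> op_space.span (commutators I)" for \<alpha> \<beta>
  proof -
    (* Passing to the diagonal operator in the basis of Tg changes Tg1 by a commutator only. *)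
    define D where "D = (\<lambda>x. schmidt_op (\<lambda>j. of_real (g1 (real j))) \<xi> \<xi> x - Tg1 x)"
    have "D \<in> commutators I"
      unfolding D_def Tg1_eq
      by (intro diagonal_difference_commutator ons bdd[OF dom_g1] in_I dom_g1)
    then have "(\<lambda>x. \<alpha> *\<^sub>C Tg x + \<beta> *\<^sub>C Tg1 x) + (\<lambda>x. \<beta> *\<^sub>C D x) \<in> op_space.span (commutators I)"
      by (intro op_space.span_add comm op_space.span_scale op_space.span_base)
    also have "(\<lambda>x. \<alpha> *\<^sub>C Tg x + \<beta> *\<^sub>C Tg1 x) + (\<lambda>x. \<beta> *\<^sub>C D x)
        = schmidt_op (\<lambda>j. \<alpha> * of_real (g (real j)) + \<beta> * of_real (g1 (real j))) \<xi> \<xi>"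
      by (rule ext) (simp add: schmidt_op_lincomb[OF ons(1,1) bdd[OF dom_g] bdd[OF dom_g1]]
          D_def Tg_eq scaleC.diff_right)
    finally have "small_compressions g
        (schmidt_op (\<lambda>j. \<alpha> * of_real (g (real j)) + \<beta> * of_real (g1 (real j))) \<xi> \<xi>)"
      by (rule small_compressions_span_commutators[rotated]) (simp add: I_iff)
    from small_compressions_diagonal[OF ons(1) g_pos' M' dominated_lincomb[OF dom_g dom_g1] this]
    obtain K where K: "\<And>n. cmod (\<Sum>j<n. \<alpha> * of_real (g (real j)) + \<beta> * of_real (g1 (real j)))
        \<le> K * real n * g (real n)"
      by blast
    define G where "G n = (\<Sum>j<n. g (real j))" for n
    define E where "E n = (\<Sum>j<n. a (real j))" for n
    have G_top: "filterlim G at_top sequentially"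
      unfolding filterlim_at_top
    proof
      fix Z
      have "\<forall>\<^sub>F n in sequentially. M * Z \<le> integral {0..real n} g"
        using filterlim_compose[OF g_int filterlim_real_sequentially] unfolding filterlim_at_top by blast
      then show "\<forall>\<^sub>F n in sequentially. Z \<le> G n"
      proof eventually_elim
        case (elim n)
        also have "integral {0..real n} g \<le> M * G n"
          unfolding G_def by (rule integral_le_sum[OF g_cont M])
        finally show ?case using M(1) by simp
      qed
    qed
    have "\<alpha> + \<beta> = 0 \<and> \<beta> = 0"
    proof (rule independent_growth[where E = E and G = G and h = "\<lambda>n. real n * g (real n)"])
      fix c :: real assume "c > 0"
      then have "c / M > 0" using M(1) by simp
      from landau_o.smallD[OF small this]
      have "\<forall>\<^sub>F t in at_top. norm (t * g t) \<le> c / M * norm (integral {0..t} a)" .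
      from eventually_compose_filterlim[OF this filterlim_real_sequentially]
      show "\<forall>\<^sub>F n in sequentially. real n * g (real n) \<le> c * E n"
      proof eventually_elim
        case (elim n)
        have "real n * g (real n) \<le> c / M * integral {0..real n} a"
          using elim int_nonneg[of n] g_pos[of "real n"] by simp
        also have "\<dots> \<le> c / M * (M * E n)"
          unfolding E_def using \<open>c / M > 0\<close>
          by (intro mult_left_mono integral_le_sum[OF a_cont M(1) a_le]) auto
        finally show ?case using M(1) by simp
      qed
      show "\<forall>\<^sub>F n in sequentially. E n \<le> c * G n"
        unfolding E_def G_def a_def
        by (rule weighted_sum_negligible[OF _ _ _ \<open>c > 0\<close>])
          (use g_pos G_top filterlim_compose[OF eps_lim filterlim_real_sequentially]
            in \<open>auto simp: G_def[abs_def]\<close>)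
    next
      show "\<forall>\<^sub>F n in sequentially. E n > 0"
        using eventually_gt_at_top[of 0]
      proof eventually_elim
        case (elim n)
        then show ?case unfolding E_def by (intro sum_pos a_pos) auto
      qed
      fix n
      show "0 \<le> real n * g (real n)" using g_pos[of "real n"] by simp
      have "(\<Sum>j<n. \<alpha> * of_real (g (real j)) + \<beta> * of_real (g1 (real j)))
          = (\<alpha> + \<beta>) * of_real (G n) + \<beta> * of_real (E n)"
        unfolding G_def E_def g1_sum
        by (simp add: sum.distrib sum_distrib_left algebra_simps)
      then show "cmod ((\<alpha> + \<beta>) * of_real (G n) + \<beta> * of_real (E n)) \<le> K * (real n * g (real n))"
        using K[of n] by (simp add: mult.assoc)
    qed
    then show ?thesis by auto
  qed

  have separation: "Tg1 \<notin> hypermeasurable I Tg \<and> Tg \<notin> hypermeasurable I Tg1 \<and>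
      hypermeasurable I Tg1 \<noteq> hypermeasurable I Tg"
    if small: "(\<lambda>t. t * g t) \<in> o[at_top](\<lambda>t. integral {0..t} a)"
  proof -
    note traces = trace_with_prescribed_values[OF independent[OF small]]
    obtain \<phi>\<^sub>1 where 1: "trace_on I \<phi>\<^sub>1" "\<phi>\<^sub>1 Tg = 1" "\<phi>\<^sub>1 Tg1 = 0" by (rule traces)
    obtain \<phi>\<^sub>2 where 2: "trace_on I \<phi>\<^sub>2" "\<phi>\<^sub>2 Tg = 0" "\<phi>\<^sub>2 Tg1 = 1" by (rule traces)
    obtain \<phi>\<^sub>3 where 3: "trace_on I \<phi>\<^sub>3" "\<phi>\<^sub>3 Tg = 1" "\<phi>\<^sub>3 Tg1 = 1" by (rule traces)
    have no: "Tg1 \<notin> hypermeasurable I Tg"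
    proof
      assume "Tg1 \<in> hypermeasurable I Tg"
      then have "\<phi>\<^sub>1 Tg1 = \<phi>\<^sub>3 Tg1" using 1 3 unfolding hypermeasurable_def by blast
      then show False using 1 3 by simp
    qed
    moreover have "Tg \<notin> hypermeasurable I Tg1"
    proof
      assume "Tg \<in> hypermeasurable I Tg1"
      then have "\<phi>\<^sub>2 Tg = \<phi>\<^sub>3 Tg" using 2 3 unfolding hypermeasurable_def by blast
      then show False using 2 3 by simp
    qed
    moreover have "Tg1 \<in> hypermeasurable I Tg1" using Tg1_I by (simp add: hypermeasurable_def)
    ultimately show ?thesis by blast
  qed

  have equal: "(\<forall>\<phi>. trace_on I \<phi> \<longrightarrow> (\<phi> Tg = 1 \<longleftrightarrow> \<phi> Tg1 = 1)) \<and>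
      hypermeasurable I Tg1 = hypermeasurable I Tg"
    if small: "(\<lambda>t. integral {0..t} a) \<in> O[at_top](\<lambda>t. t * g t)"
  proof -
    have iff: "\<phi> Tg1 = 1 \<longleftrightarrow> \<phi> Tg = 1" if "trace_on I \<phi>" for \<phi>
      using same_value[OF small that] by simp
    show ?thesis using iff hypermeasurable_cong[of I Tg1 Tg, OF iff] by blast
  qed
  show ?thesis
    using ideals equal separation unfolding I_def a_def by blast
qed

end
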